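(* Let $n\ge 2$ be an integer, let $\mathcal{X}$ be a complex Banach space of dimension greater than $1$ and let $\mathcal{A}\subseteq\mathcal{B}(\mathcal{X})$ be a standard operator algebra. Then for every multiplicative generalized Jordan $n$-derivation $\Delta:\mathcal{A}\rightarrow\mathcal{A}$ there exist $\mu\in\mathcal{Z}(\mathcal{A})$ and a derivation $\delta:\mathcal{A}\rightarrow\mathcal{A}$ such that $\Delta(t)=\mu t+\delta(t)$ for all $t\in\mathcal{A}$.
   Context: $\mathcal{B}(\mathcal{X})$ is the algebra of all bounded linear operators on $\mathcal{X}$. A standard operator algebra is a subalgebra of $\mathcal{B}(\mathcal{X})$ containing all bounded finite rank operators and the identity operator (no closedness is assumed). $\mathcal{Z}(\mathcal{A})$ is the center of $\mathcal{A}$. The Jordan product is $t_1\circ t_2=t_1t_2+t_2t_1$. Set $q_1(t_1)=t_1$ and $q_n(t_1,\ldots,t_n)=q_{n-1}(t_1,\ldots,t_{n-1})\circ t_n$ for $n\ge 2$. A map $\delta:\mathcal{A}\to\mathcal{A}$ (not assumed additive) is a multiplicative Jordan $n$-derivation if $\delta(q_n(t_1,\ldots,t_n))=\sum_{i=1}^n q_n(t_1,\ldots,t_{i-1},\delta(t_i),t_{i+1},\ldots,t_n)$ for all $t_1,\ldots,t_n\in\mathcal{A}$. A map $\Delta:\mathcal{A}\to\mathcal{A}$ (not assumed additive) is a multiplicative generalized Jordan $n$-derivation if there exists a multiplicative Jordan $n$-derivation $\delta:\mathcal{A}\to\mathcal{A}$ (not assumed additive) such that $\Delta(q_n(t_1,\ldots,t_n))=q_n(\Delta(t_1),t_2,\ldots,t_n)+\sum_{i=2}^n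 q_n(t_1,\ldots,t_{i-1},\delta(t_i),t_{i+1},\ldots,t_n)$ for all $t_1,\ldots,t_n\in\mathcal{A}$. A derivation is an additive map $d$ (not assumed linear) with $d(t_1t_2)=d(t_1)t_2+t_1d(t_2)$ for all $t_1,t_2$. *)

theory Defs
  imports "HOL-Analysis.Analysis"
begin

class complex_banach = banach +
  fixes scaleC :: "complex \<Rightarrow> 'a \<Rightarrow> 'a" (infixr "*\<^sub>C" 75)
  assumes scaleC_add_right: "a *\<^sub>C (x + y) = a *\<^sub>C x + a *\<^sub>C y"
    and scaleC_add_left: "(a + b) *\<^sub>C x = a *\<^sub>C x + b *\<^sub>C x"
    and scaleC_scaleC: "a *\<^sub>C (b *\<^sub>C x) = (a * b) *\<^sub>C x"
    and scaleC_one: "1 *\<^sub>C x = x"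
    and scaleR_scaleC: "r *\<^sub>R x = complex_of_real r *\<^sub>C x"
    and norm_scaleC: "norm (a *\<^sub>C x) = cmod a * norm x"

interpretation complex_vector: vector_space "scaleC :: complex \<Rightarrow> 'a \<Rightarrow> 'a::complex_banach"
  by unfold_locales (simp_all add: scaleC_add_right scaleC_add_left scaleC_scaleC scaleC_one)

text \<open>The library's \<open>vector_space.dim\<close> is 0 for infinite-dimensional spaces, so the
  dimension condition is stated through a Hamel basis, which may be infinite.\<close>

definition complex_dim_gt_one :: "'a::complex_banach itself \<Rightarrow> bool" where
  "complex_dim_gt_one _ \<longleftrightarrow>
    (\<exists>B :: 'a set. complex_vector.independent B \<and> complex_vector.span B = UNIV \<and>
      (infinite B \<or> card B > 1))"

text \<open>The type \<open>'a \<Rightarrow>\<^sub>L 'a\<close> consists of the bounded real-linear operators; \<open>\<B>(X)\<close> is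
  the subset of complex-linear ones.\<close>

definition bounded_operators :: "('a::complex_banach \<Rightarrow>\<^sub>L 'a) set" where
  "bounded_operators = {T. \<forall>c x. blinfun_apply T (c *\<^sub>C x) = c *\<^sub>C blinfun_apply T x}"

lift_definition scaleC_blinfun ::
    "complex \<Rightarrow> ('a::complex_banach \<Rightarrow>\<^sub>L 'a) \<Rightarrow> ('a \<Rightarrow>\<^sub>L 'a)"
  is "\<lambda>c T x. c *\<^sub>C T x"
proof -
  fix c :: complex and T :: "'a \<Rightarrow> 'a"
  assume T: "bounded_linear T"
  have "bounded_linear (\<lambda>x::'a. c *\<^sub>C x)"
  proof (rule bounded_linear_intro[where K = "cmod c"])
    show "c *\<^sub>C (x + y) = c *\<^sub>C x + c *\<^sub>C y" for x y :: 'a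
      by (rule scaleC_add_right)
    show "c *\<^sub>C (r *\<^sub>R x) = r *\<^sub>R (c *\<^sub>C x)" for r and x :: 'a
      by (simp add: scaleR_scaleC scaleC_scaleC mult.commute)
    show "norm (c *\<^sub>C x) \<le> norm x * cmod c" for x :: 'a
      by (simp add: norm_scaleC mult.commute)
  qed
  from bounded_linear_compose[OF this T] show "bounded_linear (\<lambda>x. c *\<^sub>C T x)" .
qed

definition finite_rank :: "('a::complex_banach \<Rightarrow>\<^sub>L 'a) \<Rightarrow> bool" where
  "finite_rank T \<longleftrightarrow> (\<exists>F. finite F \<and> range (blinfun_apply T) = complex_vector.span F)"

definition operator_subalgebra :: "('a::complex_banach \<Rightarrow>\<^sub>L 'a) set \<Rightarrow> bool" where
  "operator_subalgebra A \<longleftrightarrow>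
    A \<subseteq> bounded_operators \<and> 0 \<in> A \<and>
    (\<forall>S\<in>A. \<forall>T\<in>A. S + T \<in> A) \<and>
    (\<forall>c. \<forall>T\<in>A. scaleC_blinfun c T \<in> A) \<and>
    (\<forall>S\<in>A. \<forall>T\<in>A. S o\<^sub>L T \<in> A)"

definition standard_operator_algebra :: "('a::complex_banach \<Rightarrow>\<^sub>L 'a) set \<Rightarrow> bool" where
  "standard_operator_algebra A \<longleftrightarrow>
    operator_subalgebra A \<and> id_blinfun \<in> A \<and>
    (\<forall>T\<in>bounded_operators. finite_rank T \<longrightarrow> T \<in> A)"

definition center :: "('a::complex_banach \<Rightarrow>\<^sub>L 'a) set \<Rightarrow> ('a \<Rightarrow>\<^sub>L 'a) set" where
  "center A = {S \<in> A. \<forall>T\<in>A. S o\<^sub>L T = T o\<^sub>L S}"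

definition jordan_product ::
    "('a::complex_banach \<Rightarrow>\<^sub>L 'a) \<Rightarrow> ('a \<Rightarrow>\<^sub>L 'a) \<Rightarrow> ('a \<Rightarrow>\<^sub>L 'a)" where
  "jordan_product S T = (S o\<^sub>L T) + (T o\<^sub>L S)"

text \<open>Only the entries \<open>t 1, \<dots>, t n\<close> enter \<open>jordan_q n t\<close>; the value at \<open>n = 0\<close> is a dummy.\<close>

fun jordan_q :: "nat \<Rightarrow> (nat \<Rightarrow> ('a::complex_banach \<Rightarrow>\<^sub>L 'a)) \<Rightarrow> ('a \<Rightarrow>\<^sub>L 'a)" where
  "jordan_q 0 t = 0"
| "jordan_q (Suc 0) t = t 1"
| "jordan_q (Suc (Suc n)) t = jordan_product (jordan_q (Suc n) t) (t (Suc (Suc n)))"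

definition mult_jordan_derivation ::
    "nat \<Rightarrow> ('a::complex_banach \<Rightarrow>\<^sub>L 'a) set \<Rightarrow> (('a \<Rightarrow>\<^sub>L 'a) \<Rightarrow> ('a \<Rightarrow>\<^sub>L 'a)) \<Rightarrow> bool" where
  "mult_jordan_derivation n A \<delta> \<longleftrightarrow>
    \<delta> \<in> A \<rightarrow> A \<and>
    (\<forall>t. (\<forall>i\<in>{1..n}. t i \<in> A) \<longrightarrow>
      \<delta> (jordan_q n t) = (\<Sum>i=1..n. jordan_q n (t(i := \<delta> (t i)))))"

definition mult_gen_jordan_derivation ::
    "nat \<Rightarrow> ('a::complex_banach \<Rightarrow>\<^sub>L 'a) set \<Rightarrow> (('a \<Rightarrow>\<^sub>L 'a) \<Rightarrow> ('a \<Rightarrow>\<^sub>L 'a)) \<Rightarrow> bool" where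
  "mult_gen_jordan_derivation n A \<Delta> \<longleftrightarrow>
    \<Delta> \<in> A \<rightarrow> A \<and>
    (\<exists>\<delta>. mult_jordan_derivation n A \<delta> \<and>
      (\<forall>t. (\<forall>i\<in>{1..n}. t i \<in> A) \<longrightarrow>
        \<Delta> (jordan_q n t) =
          jordan_q n (t(1 := \<Delta> (t 1))) + (\<Sum>i=2..n. jordan_q n (t(i := \<delta> (t i))))))"

definition derivation ::
    "('a::complex_banach \<Rightarrow>\<^sub>L 'a) set \<Rightarrow> (('a \<Rightarrow>\<^sub>L 'a) \<Rightarrow> ('a \<Rightarrow>\<^sub>L 'a)) \<Rightarrow> bool" where
  "derivation A d \<longleftrightarrow>
    d \<in> A \<rightarrow> A \<and>
    (\<forall>S\<in>A. \<forall>T\<in>A. d (S + T) = d S + d T) \<and>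
    (\<forall>S\<in>A. \<forall>T\<in>A. d (S o\<^sub>L T) = (d S o\<^sub>L T) + (S o\<^sub>L d T))"

end

theory Submission imports Defs begin

text \<open>
  Write \<open>x \<odot> y = (x y + y x)/2\<close>, so that the identity \<open>1\<close> is a unit for \<open>\<odot>\<close>. Let \<open>\<delta>\<close> be
  a multiplicative Jordan \<open>n\<close>-derivation and \<open>c = \<delta> 1\<close>. Filling all entries but two with \<open>1\<close>
  turns its defining identity into
  \<open>\<delta> (N (x \<odot> y)) = N (\<delta> x \<odot> y + x \<odot> \<delta> y + (n - 2) (x \<odot> y) \<odot> c)\<close> with \<open>N = 2^(n-1)\<close>.
  Comparing this with the same identity for the pair \<open>x \<odot> y, 1\<close> removes \<open>N\<close>, and
  \<open>\<delta> (x \<odot> y) = \<delta> x \<odot> y + x \<odot> \<delta> y - (x \<odot> y) \<odot> c\<close> remains. For an idempotent \<open>x = y\<close> this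
  says that \<open>c\<close> commutes with it, and an element that commutes with all idempotents is central
  (\<open>twisted_unit_central\<close>). Hence \<open>d x = \<delta> x - c x\<close> satisfies the Leibniz rule for \<open>\<odot>\<close>.

  Such a \<open>d\<close> is additive (\<open>jordan_leibniz_additive\<close>): the Peirce decomposition of
  an idempotent is an eigenspace decomposition for \<open>\<odot>\<close>, so \<open>d\<close> respects it after subtraction
  of an inner derivation. The Leibniz rule for products such as \<open>(e + a) \<odot> ((1 - e) + b)\<close>,
  whose off-diagonal part is \<open>(a + b)/2\<close>, then becomes additivity on the components. Additivity
  gives \<open>d (N 1) = N d 1 = 0\<close>, that is \<open>\<delta> (N 1) = N c\<close>, whereas the identity above gives
  \<open>n N c\<close>; so \<open>c = 0\<close>. Now \<open>\<delta>\<close> is an additive Jordan derivation of a noncommutative prime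
  algebra, and these are derivations (\<open>jordan_derivation_is_derivation\<close>, a theorem of Herstein).

  For the generalized map \<open>\<Delta>\<close>, the same substitution shows that \<open>g = \<Delta> - \<delta>\<close> satisfies
  \<open>g (x \<odot> y) = g x \<odot> y\<close>, so \<open>g x = g 1 \<odot> x\<close>. Symmetry in \<open>x\<close> and \<open>y\<close> makes \<open>g 1\<close> commute
  with all commutators, which in a prime algebra makes it central
  (\<open>scaled_jordan_centralizer_is_multiplication\<close>).

  The algebra enters only through primeness and an idempotent other than \<open>0\<close> and \<open>1\<close>. Both come
  from rank-one operators \<open>x \<mapsto> g x u\<close>, and thus from the existence of enough continuous
  functionals \<open>g\<close>, that is, from the Hahn-Banach theorem.
\<close>

section \<open>The Hahn-Banach theorem\<close>

definition sublinear :: "('a::real_vector \<Rightarrow> real) \<Rightarrow> bool" where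
  "sublinear p \<longleftrightarrow> (\<forall>x y. p (x + y) \<le> p x + p y) \<and> (\<forall>c>0. \<forall>x. p (c *\<^sub>R x) \<le> c * p x)"

lemma sublinearD:
  assumes "sublinear p"
  shows "p (x + y) \<le> p x + p y" "p 0 = 0" "c \<ge> 0 \<Longrightarrow> p (c *\<^sub>R x) = c * p x" "- p (- x) \<le> p x"
proof -
  show add: "p (x + y) \<le> p x + p y" for x y using assms by (simp add: sublinear_def)
  have le: "p (c *\<^sub>R x) \<le> c * p x" if "c > 0" for c x using assms that by (simp add: sublinear_def)
  show zero: "p 0 = 0" using add[of 0 0] le[of "1/2" 0] by simp
  show "p (c *\<^sub>R x) = c * p x" if "c \<ge> 0"
  proof (cases "c = 0")
    case False
    then have "p x \<le> inverse c * p (c *\<^sub>R x)" using le[of "inverse c" "c *\<^sub>R x"] that by simp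
    then have "c * p x \<le> p (c *\<^sub>R x)" using False that by (simp add: field_simps)
    then show ?thesis using le[of c x] False that by simp
  qed (simp add: zero)
  show "- p (- x) \<le> p x" using add[of x "- x"] zero by simp
qed

text \<open>The largest sublinear functional below \<open>p\<close> that is at most \<open>- p y\<close> at \<open>- y\<close>. It both proves
  that minimal sublinear functionals are additive and forces a prescribed value at one vector.\<close>

definition shifted :: "('a::real_vector \<Rightarrow> real) \<Rightarrow> 'a \<Rightarrow> 'a \<Rightarrow> real" where
  "shifted p y x = (INF t\<in>{0..}. p (x + t *\<^sub>R y) - t * p y)"

lemma shifted_le:
  assumes p: "sublinear p" and t: "t \<ge> 0"
  shows "shifted p y x \<le> p (x + t *\<^sub>R y) - t * p y"
  unfolding shifted_def
proof (rule cINF_lower)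
  show "bdd_below ((\<lambda>t. p (x + t *\<^sub>R y) - t * p y) ` {0..})"
  proof (rule bdd_belowI2)
    fix s :: real assume "s \<in> {0..}"
    then show "- p (- x) \<le> p (x + s *\<^sub>R y) - s * p y"
      using sublinearD(1)[OF p, of "x + s *\<^sub>R y" "- x"] sublinearD(3)[OF p, of s y] by simp
  qed
qed (use t in simp)

lemma shifted_greatest:
  assumes "\<And>t. t \<ge> 0 \<Longrightarrow> m \<le> p (x + t *\<^sub>R y) - t * p y"
  shows "m \<le> shifted p y x"
  unfolding shifted_def using assms by (intro cINF_greatest) auto

lemma sublinear_shifted:
  assumes p: "sublinear p"
  shows "sublinear (shifted p y)"
  unfolding sublinear_def
proof (intro conjI allI impI)
  fix x x'
  have "shifted p y (x + x') - (p (x' + t *\<^sub>R y) - t * p y) \<le> p (x + s *\<^sub>R y) - s * p y"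
    if "s \<ge> 0" "t \<ge> 0" for s t
  proof -
    have "x + x' + (s + t) *\<^sub>R y = (x + s *\<^sub>R y) + (x' + t *\<^sub>R y)" by (simp add: algebra_simps)
    then show ?thesis
      using shifted_le[OF p, of "s + t" y "x + x'"] that
        sublinearD(1)[OF p, of "x + s *\<^sub>R y" "x' + t *\<^sub>R y"] by (simp add: algebra_simps)
  qed
  then have "shifted p y (x + x') - (p (x' + t *\<^sub>R y) - t * p y) \<le> shifted p y x" if "t \<ge> 0" for t
    using that by (intro shifted_greatest)
  then have "shifted p y (x + x') - shifted p y x \<le> p (x' + t *\<^sub>R y) - t * p y" if "t \<ge> 0" for t
    using that by (simp add: algebra_simps)
  then have "shifted p y (x + x') - shifted p y x \<le> shifted p y x'"
    by (rule shifted_greatest)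
  then show "shifted p y (x + x') \<le> shifted p y x + shifted p y x'" by simp
next
  fix c :: real and x assume c: "c > 0"
  have "inverse c * shifted p y (c *\<^sub>R x) \<le> p (x + t *\<^sub>R y) - t * p y" if t: "t \<ge> 0" for t
  proof -
    have "shifted p y (c *\<^sub>R x) \<le> p (c *\<^sub>R (x + t *\<^sub>R y)) - c * t * p y"
      using shifted_le[OF p, of "c * t" y "c *\<^sub>R x"] c t by (simp add: algebra_simps)
    also have "\<dots> = c * (p (x + t *\<^sub>R y) - t * p y)"
      by (simp only: sublinearD(3)[OF p less_imp_le[OF c]] right_diff_distrib mult.assoc)
    finally show ?thesis using c by (simp add: field_simps)
  qed
  then have "inverse c * shifted p y (c *\<^sub>R x) \<le> shifted p y x" by (rule shifted_greatest)
  then show "shifted p y (c *\<^sub>R x) \<le> c * shifted p y x" using c by (simp add: field_simps)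
qed

lemma shifted_below: "sublinear p \<Longrightarrow> shifted p y x \<le> p x"
  using shifted_le[of p 0 y x] by simp

lemma shifted_uminus: "sublinear p \<Longrightarrow> shifted p y (- y) \<le> - p y"
  using shifted_le[of p 1 y "- y"] sublinearD(2)[of p] by simp

text \<open>The bound \<open>- q (- x) \<le> p x\<close>, valid for every sublinear \<open>p \<le> q\<close>, keeps the infimum finite;
  subadditivity survives because two members of a chain have a common lower bound in it.\<close>

lemma sublinear_chain_Inf:
  fixes C :: "('a::real_vector \<Rightarrow> real) set"
  assumes ne: "C \<noteq> {}" and sub: "\<And>p. p \<in> C \<Longrightarrow> sublinear p \<and> p \<le> q" and q: "sublinear q"
    and chain: "\<And>p p'. \<lbrakk>p \<in> C; p' \<in> C\<rbrakk> \<Longrightarrow> p \<le> p' \<or> p' \<le> p"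
  shows "sublinear (\<lambda>x. INF p\<in>C. p x)" "p \<in> C \<Longrightarrow> (INF p\<in>C. p x) \<le> p x"
proof -
  have bdd: "bdd_below ((\<lambda>p. p x) ` C)" for x
  proof (rule bdd_belowI2)
    fix p assume "p \<in> C"
    then have "sublinear p" "p (- x) \<le> q (- x)" using sub by (auto simp: le_fun_def)
    then show "- q (- x) \<le> p x" using sublinearD(4)[of p x] by simp
  qed
  show low: "(INF p\<in>C. p x) \<le> p x" if "p \<in> C" for p x
    using bdd that by (rule cINF_lower)
  show "sublinear (\<lambda>x. INF p\<in>C. p x)"
    unfolding sublinear_def
  proof (intro conjI allI impI)
    fix x y
    have "(INF p\<in>C. p (x + y)) \<le> p x + p' y" if pp: "p \<in> C" "p' \<in> C" for p p'
    proof -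
      obtain r where r: "r \<in> C" "r \<le> p" "r \<le> p'" using chain[OF pp] pp by auto
      then have "(INF p\<in>C. p (x + y)) \<le> r x + r y"
        using low[OF r(1), of "x + y"] sublinearD(1)[of r x y] sub by fastforce
      then show ?thesis using r(2,3) by (meson add_mono le_funD order_trans)
    qed
    then have "(INF p\<in>C. p (x + y)) - p' y \<le> (INF p\<in>C. p x)" if "p' \<in> C" for p'
      using that ne by (intro cINF_greatest) (auto simp: algebra_simps)
    then have "(INF p\<in>C. p (x + y)) - (INF p\<in>C. p x) \<le> (INF p\<in>C. p y)"
      using ne by (intro cINF_greatest) (auto simp: algebra_simps)
    then show "(INF p\<in>C. p (x + y)) \<le> (INF p\<in>C. p x) + (INF p\<in>C. p y)" by simp
  next
    fix c :: real and x assume c: "c > 0"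
    have "inverse c * (INF p\<in>C. p (c *\<^sub>R x)) \<le> p x" if "p \<in> C" for p
      using low[OF that, of "c *\<^sub>R x"] sublinearD(3)[of p c x] sub[OF that] c by (simp add: field_simps)
    then have "inverse c * (INF p\<in>C. p (c *\<^sub>R x)) \<le> (INF p\<in>C. p x)"
      using ne by (intro cINF_greatest) auto
    then show "(INF p\<in>C. p (c *\<^sub>R x)) \<le> c * (INF p\<in>C. p x)" using c by (simp add: field_simps)
  qed
qed

text \<open>Minimality gives \<open>shifted p y = p\<close>, and the value \<open>t = 1\<close> in the infimum then reads
  \<open>p x \<le> p (x + y) - p y\<close>, the missing half of additivity.\<close>

lemma minimal_sublinear_linear:
  assumes p: "sublinear p" and min: "\<And>r. \<lbrakk>sublinear r; r \<le> p\<rbrakk> \<Longrightarrow> r = p"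
  shows "linear p"
proof -
  have add: "p (x + y) = p x + p y" for x y
  proof (rule antisym[OF sublinearD(1)[OF p]])
    have "shifted p y = p"
      using min sublinear_shifted[OF p] shifted_below[OF p] by (simp add: le_fun_def)
    then show "p x + p y \<le> p (x + y)" using shifted_le[OF p, of 1 y x] by simp
  qed
  have minus: "p (- x) = - p x" for x using add[of x "- x"] sublinearD(2)[OF p] by simp
  have "p (c *\<^sub>R x) = c * p x" for c x
    using sublinearD(3)[OF p, of c x] sublinearD(3)[OF p, of "- c" x] minus[of "c *\<^sub>R x"]
    by (cases "c \<ge> 0") auto
  then show ?thesis by (intro linearI) (simp_all add: add)
qed

text \<open>The Hahn-Banach theorem in the form that needs no subspaces: by Zorn's lemma there is a minimal
  sublinear functional below \<open>q\<close>.\<close>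

theorem sublinear_dominates_linear:
  assumes q: "sublinear (q :: 'a::real_vector \<Rightarrow> real)"
  obtains f where "linear f" "f \<le> q"
proof -
  let ?S = "{p. sublinear p \<and> p \<le> q}"
  have "\<exists>m\<in>?S. \<forall>a\<in>?S. m \<ge> a \<longrightarrow> a = m"
  proof (rule predicate_Zorn)
    show "partial_order_on ?S (relation_of (\<ge>) ?S)"
      by (rule partial_order_on_relation_ofI) auto
    fix C assume C: "C \<in> Chains (relation_of (\<ge>) ?S)"
    show "\<exists>u\<in>?S. \<forall>a\<in>C. a \<ge> u"
    proof (cases "C = {}")
      case True
      then show ?thesis using q by auto
    next
      case False
      have CS: "C \<subseteq> ?S" using C by (rule Chains_relation_of)
      have ch: "p \<le> p' \<or> p' \<le> p" if "p \<in> C" "p' \<in> C" for p p'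
        using C that by (auto simp: Chains_def relation_of_def)
      have sub: "sublinear p \<and> p \<le> q" if "p \<in> C" for p using CS that by auto
      note Inf = sublinear_chain_Inf[of C q, OF False sub q ch]
      have lower: "(\<lambda>x. INF p\<in>C. p x) \<le> p" if "p \<in> C" for p
        using Inf(2) that by (simp add: le_fun_def)
      obtain p where "p \<in> C" using False by auto
      then have "(\<lambda>x. INF p\<in>C. p x) \<le> q" using lower sub order_trans by blast
      then show ?thesis using lower Inf(1) by blast
    qed
  qed
  then obtain m where m: "sublinear m" "m \<le> q" "\<And>a. \<lbrakk>sublinear a; a \<le> q; a \<le> m\<rbrakk> \<Longrightarrow> a = m" by auto
  have "linear m" using m by (intro minimal_sublinear_linear) (auto intro: order_trans)
  then show thesis using that m(2) by blast
qed

text \<open>Starting from \<open>shifted norm v\<close> instead of the norm itself makes the value at \<open>- v\<close> at most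
  \<open>- norm v\<close>, so the functional attains the norm at \<open>v\<close>.\<close>

corollary exists_norming_functional:
  fixes v :: "'a::real_normed_vector"
  obtains f where "linear f" "\<And>x. \<bar>f x\<bar> \<le> norm x" "f v = norm v"
proof -
  have n: "sublinear (norm :: 'a \<Rightarrow> real)"
    by (auto simp: sublinear_def norm_triangle_ineq)
  obtain f where f: "linear f" "f \<le> shifted norm v"
    using sublinear_dominates_linear[OF sublinear_shifted[OF n]] .
  have le: "f x \<le> norm x" for x
    using le_funD[OF f(2), of x] shifted_below[OF n, of v x] by simp
  have "\<bar>f x\<bar> \<le> norm x" for x using le[of x] le[of "- x"] linear_neg[OF f(1), of x] by simp
  moreover have "f v = norm v"
    using le_funD[OF f(2), of "- v"] shifted_uminus[OF n, of v] linear_neg[OF f(1), of v] le[of v] by simp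
  ultimately show thesis using that f(1) by blast
qed

section \<open>Jordan derivations of prime algebras\<close>

text \<open>The multiplication is a parameter so that it can be the composition \<open>o\<^sub>L\<close>, whose operands
  have different types in general. It obeys the algebra laws on the whole type;
  only the closure properties and primeness refer to \<open>A\<close>.\<close>

locale prime_algebra =
  fixes A :: "'r::real_vector set"
    and mult :: "'r \<Rightarrow> 'r \<Rightarrow> 'r" (infixl "\<cdot>" 70)
    and unit :: 'r ("\<one>")
  assumes assoc: "x \<cdot> y \<cdot> z = x \<cdot> (y \<cdot> z)"
    and add_mult: "(x + y) \<cdot> z = x \<cdot> z + y \<cdot> z"
    and mult_add: "x \<cdot> (y + z) = x \<cdot> y + x \<cdot> z"
    and scaleR_mult: "(r *\<^sub>R x) \<cdot> y = r *\<^sub>R (x \<cdot> y)"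
    and mult_scaleR: "x \<cdot> (r *\<^sub>R y) = r *\<^sub>R (x \<cdot> y)"
    and unit_mult [simp]: "\<one> \<cdot> x = x"
    and mult_unit [simp]: "x \<cdot> \<one> = x"
    and unit_in [simp]: "\<one> \<in> A"
    and add_in [simp]: "\<lbrakk>x \<in> A; y \<in> A\<rbrakk> \<Longrightarrow> x + y \<in> A"
    and scaleR_in [simp]: "x \<in> A \<Longrightarrow> r *\<^sub>R x \<in> A"
    and mult_in [simp]: "\<lbrakk>x \<in> A; y \<in> A\<rbrakk> \<Longrightarrow> x \<cdot> y \<in> A"
    and prime: "\<lbrakk>x \<in> A; y \<in> A; \<And>a. a \<in> A \<Longrightarrow> x \<cdot> a \<cdot> y = 0\<rbrakk> \<Longrightarrow> x = 0 \<or> y = 0"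
begin

lemma uminus_in [simp]: "x \<in> A \<Longrightarrow> - x \<in> A"
  using scaleR_in[of x "-1"] by simp

lemma diff_in [simp]: "\<lbrakk>x \<in> A; y \<in> A\<rbrakk> \<Longrightarrow> x - y \<in> A"
  using add_in[of x "- y"] by simp

lemma zero_in [simp]: "0 \<in> A"
  using scaleR_in[OF unit_in, of 0] by simp

lemma zero_mult [simp]: "0 \<cdot> x = 0"
  using scaleR_mult[of 0 x x] by simp

lemma mult_zero [simp]: "x \<cdot> 0 = 0"
  using mult_scaleR[of x 0 x] by simp

lemma minus_mult: "(- x) \<cdot> y = - (x \<cdot> y)"
  using scaleR_mult[of "-1" x y] by simp

lemma mult_minus: "x \<cdot> (- y) = - (x \<cdot> y)"
  using mult_scaleR[of x "-1" y] by simp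

lemma diff_mult: "(x - y) \<cdot> z = x \<cdot> z - y \<cdot> z"
  using add_mult[of x "- y" z] by (simp add: minus_mult)

lemma mult_diff: "x \<cdot> (y - z) = x \<cdot> y - x \<cdot> z"
  using mult_add[of x y "- z"] by (simp add: mult_minus)

lemmas ring_rules = assoc add_mult mult_add scaleR_mult mult_scaleR minus_mult mult_minus
  diff_mult mult_diff

lemma double_cancel: "x + x = y + y \<Longrightarrow> x = (y::'r)"
  by (metis scaleR_2 scaleR_cancel_left zero_neq_numeral)

lemma semiprime: "\<lbrakk>x \<in> A; \<And>a. a \<in> A \<Longrightarrow> x \<cdot> a \<cdot> x = 0\<rbrakk> \<Longrightarrow> x = 0"
  using prime[of x x] by blast

definition central :: "'r \<Rightarrow> bool" where
  "central c \<longleftrightarrow> (\<forall>x\<in>A. c \<cdot> x = x \<cdot> c)"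

text \<open>Applying the hypothesis to different bracketings of \<open>a x b y a x b\<close> shows that this element is
  its own negative, so it vanishes for every \<open>y\<close>, and semiprimeness applies.\<close>

lemma skew_sandwich_zero:
  assumes a: "a \<in> A" and b: "b \<in> A"
    and skew: "\<And>x. x \<in> A \<Longrightarrow> a \<cdot> x \<cdot> b + b \<cdot> x \<cdot> a = 0" and x: "x \<in> A"
  shows "a \<cdot> x \<cdot> b = 0"
proof (rule semiprime)
  show "a \<cdot> x \<cdot> b \<in> A" using a b x by simp
  have sk: "a \<cdot> (z \<cdot> b) = - (b \<cdot> (z \<cdot> a))" if "z \<in> A" for z
    using skew[OF that] by (simp add: ring_rules eq_neg_iff_add_eq_0)
  fix y assume y: "y \<in> A"
  have "a \<cdot> (x \<cdot> (b \<cdot> (y \<cdot> (a \<cdot> (x \<cdot> b))))) = - (a \<cdot> (x \<cdot> (a \<cdot> (y \<cdot> (b \<cdot> (x \<cdot> b))))))"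
  proof -
    have "b \<cdot> (y \<cdot> a) = - (a \<cdot> (y \<cdot> b))" using sk[OF y] by simp
    then have "a \<cdot> x \<cdot> (b \<cdot> (y \<cdot> a)) \<cdot> (x \<cdot> b) = a \<cdot> x \<cdot> - (a \<cdot> (y \<cdot> b)) \<cdot> (x \<cdot> b)" by simp
    then show ?thesis by (simp add: ring_rules)
  qed
  also have "\<dots> = b \<cdot> (x \<cdot> (a \<cdot> (y \<cdot> (a \<cdot> (x \<cdot> b)))))"
  proof -
    have "a \<cdot> ((x \<cdot> a \<cdot> y) \<cdot> b) = - (b \<cdot> ((x \<cdot> a \<cdot> y) \<cdot> a))" using a x y by (intro sk) simp
    then have "a \<cdot> ((x \<cdot> a \<cdot> y) \<cdot> b) \<cdot> (x \<cdot> b) = - (b \<cdot> ((x \<cdot> a \<cdot> y) \<cdot> a)) \<cdot> (x \<cdot> b)" by simp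
    then show ?thesis by (simp add: ring_rules)
  qed
  also have "\<dots> = - (a \<cdot> (x \<cdot> (b \<cdot> (y \<cdot> (a \<cdot> (x \<cdot> b))))))"
  proof -
    have "b \<cdot> (x \<cdot> a) \<cdot> (y \<cdot> (a \<cdot> (x \<cdot> b))) = - (a \<cdot> (x \<cdot> b)) \<cdot> (y \<cdot> (a \<cdot> (x \<cdot> b)))"
      using sk[OF x] by simp
    then show ?thesis by (simp add: ring_rules)
  qed
  finally have "a \<cdot> (x \<cdot> (b \<cdot> (y \<cdot> (a \<cdot> (x \<cdot> b))))) = 0"
    by (metis equation_minus_iff eq_neg_iff_add_eq_0 scaleR_2 scaleR_eq_0_iff zero_neq_numeral)
  then show "a \<cdot> x \<cdot> b \<cdot> y \<cdot> (a \<cdot> x \<cdot> b) = 0" by (simp add: ring_rules)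
qed

text \<open>Comparing the hypothesis for \<open>[s, t]\<close> and for \<open>[s, t s] = [s, t] s\<close> gives \<open>[s, t] [c, s] = 0\<close>.
  Replacing \<open>t\<close> by \<open>c r\<close> then yields \<open>[c, s] r [c, s] = 0\<close> for all \<open>r\<close>.\<close>

lemma commutes_with_commutators_central:
  assumes c: "c \<in> A"
    and comm: "\<And>s t. \<lbrakk>s \<in> A; t \<in> A\<rbrakk> \<Longrightarrow> c \<cdot> (s \<cdot> t - t \<cdot> s) = (s \<cdot> t - t \<cdot> s) \<cdot> c"
  shows "central c"
  unfolding central_def
proof
  fix s assume s: "s \<in> A"
  have *: "(s \<cdot> t - t \<cdot> s) \<cdot> (c \<cdot> s - s \<cdot> c) = 0" if t: "t \<in> A" for t
  proof -
    have "(s \<cdot> t - t \<cdot> s) \<cdot> s \<cdot> c = c \<cdot> (s \<cdot> t - t \<cdot> s) \<cdot> s"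
      using comm[OF s mult_in[OF t s]] by (simp add: ring_rules)
    also have "\<dots> = (s \<cdot> t - t \<cdot> s) \<cdot> c \<cdot> s" using comm[OF s t] by simp
    finally show ?thesis by (simp only: mult_diff assoc cancel_comm_monoid_add_class.diff_cancel)
  qed
  have "c \<cdot> s - s \<cdot> c = 0"
  proof (rule semiprime)
    show "c \<cdot> s - s \<cdot> c \<in> A" using c s by simp
    fix r assume r: "r \<in> A"
    have "(s \<cdot> (c \<cdot> r) - c \<cdot> r \<cdot> s) \<cdot> (c \<cdot> s - s \<cdot> c) = 0" using * c r by simp
    moreover have "c \<cdot> ((s \<cdot> r - r \<cdot> s) \<cdot> (c \<cdot> s - s \<cdot> c)) = 0" using *[OF r] by simp
    moreover have "(c \<cdot> s - s \<cdot> c) \<cdot> r \<cdot> w = c \<cdot> ((s \<cdot> r - r \<cdot> s) \<cdot> w) - (s \<cdot> (c \<cdot> r) - c \<cdot> r \<cdot> s) \<cdot> w" for w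
      by (simp add: ring_rules)
    ultimately show "(c \<cdot> s - s \<cdot> c) \<cdot> r \<cdot> (c \<cdot> s - s \<cdot> c) = 0"
      by simp
  qed
  then show "c \<cdot> s = s \<cdot> c" by simp
qed

text \<open>Herstein's theorem, with Bresar's proof. The defect \<open>\<theta> a b = D (a b) - D a b - a D b\<close> is additive
  in its second argument and skew. Expanding \<open>D\<close> on \<open>a b z b a + b a z a b\<close> in two ways shows that
  \<open>\<theta> a b\<close> and the commutator \<open>[a, b]\<close> satisfy the hypothesis of \<open>skew_sandwich_zero\<close>; linearising
  in \<open>b\<close> gives \<open>\<theta> a b z [a, c] = 0\<close> for all \<open>c\<close>. By primeness \<open>\<theta> a\<close> vanishes for
  noncentral \<open>a\<close>, and a central element is the difference of two noncentral ones.\<close>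

theorem jordan_derivation_is_derivation:
  assumes noncomm: "\<not> (\<forall>x\<in>A. central x)"
    and D: "\<And>x. x \<in> A \<Longrightarrow> D x \<in> A"
    and add: "\<And>x y. \<lbrakk>x \<in> A; y \<in> A\<rbrakk> \<Longrightarrow> D (x + y) = D x + D y"
    and jordan: "\<And>x y. \<lbrakk>x \<in> A; y \<in> A\<rbrakk> \<Longrightarrow> D (x \<cdot> y + y \<cdot> x) = D x \<cdot> y + x \<cdot> D y + D y \<cdot> x + y \<cdot> D x"
    and "x \<in> A" "y \<in> A"
  shows "D (x \<cdot> y) = D x \<cdot> y + x \<cdot> D y"
proof -
  have square: "D (a \<cdot> a) = D a \<cdot> a + a \<cdot> D a" if a: "a \<in> A" for a
    by (rule double_cancel) (use jordan[OF a a] add[of "a \<cdot> a" "a \<cdot> a"] a in \<open>simp add: algebra_simps\<close>)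
  \<comment> \<open>the triple product \<open>a b a\<close> is half of \<open>a \<circ> (a \<circ> b) - a^2 \<circ> b\<close>, where \<open>x \<circ> y = x y + y x\<close>\<close>
  have triple: "D (a \<cdot> b \<cdot> a) = D a \<cdot> b \<cdot> a + a \<cdot> D b \<cdot> a + a \<cdot> b \<cdot> D a"
    if a: "a \<in> A" and b: "b \<in> A" for a b
  proof (rule double_cancel)
    have "D (a \<cdot> (a \<cdot> b + b \<cdot> a) + (a \<cdot> b + b \<cdot> a) \<cdot> a)
        = D a \<cdot> (a \<cdot> b + b \<cdot> a) + a \<cdot> D (a \<cdot> b + b \<cdot> a) + D (a \<cdot> b + b \<cdot> a) \<cdot> a + (a \<cdot> b + b \<cdot> a) \<cdot> D a"
      using a b by (intro jordan) auto
    moreover have "D (a \<cdot> a \<cdot> b + b \<cdot> (a \<cdot> a)) = D (a \<cdot> a) \<cdot> b + a \<cdot> a \<cdot> D b + D b \<cdot> (a \<cdot> a) + b \<cdot> D (a \<cdot> a)"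
      using a b by (intro jordan) auto
    moreover have "a \<cdot> (a \<cdot> b + b \<cdot> a) + (a \<cdot> b + b \<cdot> a) \<cdot> a = (a \<cdot> b \<cdot> a + a \<cdot> b \<cdot> a) + (a \<cdot> a \<cdot> b + b \<cdot> (a \<cdot> a))"
      by (simp add: ring_rules algebra_simps)
    moreover have "D ((a \<cdot> b \<cdot> a + a \<cdot> b \<cdot> a) + (a \<cdot> a \<cdot> b + b \<cdot> (a \<cdot> a)))
        = D (a \<cdot> b \<cdot> a) + D (a \<cdot> b \<cdot> a) + D (a \<cdot> a \<cdot> b + b \<cdot> (a \<cdot> a))"
      using a b by (simp add: add)
    ultimately show "D (a \<cdot> b \<cdot> a) + D (a \<cdot> b \<cdot> a)
      = (D a \<cdot> b \<cdot> a + a \<cdot> D b \<cdot> a + a \<cdot> b \<cdot> D a) + (D a \<cdot> b \<cdot> a + a \<cdot> D b \<cdot> a + a \<cdot> b \<cdot> D a)"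
      using a b by (simp add: ring_rules algebra_simps square jordan)
  qed
  have triple2: "D (a \<cdot> b \<cdot> c + c \<cdot> b \<cdot> a)
      = D a \<cdot> b \<cdot> c + a \<cdot> D b \<cdot> c + a \<cdot> b \<cdot> D c + D c \<cdot> b \<cdot> a + c \<cdot> D b \<cdot> a + c \<cdot> b \<cdot> D a"
    if a: "a \<in> A" and b: "b \<in> A" and c: "c \<in> A" for a b c
  proof -
    have "D ((a + c) \<cdot> b \<cdot> (a + c)) = D (a \<cdot> b \<cdot> a + c \<cdot> b \<cdot> c + (a \<cdot> b \<cdot> c + c \<cdot> b \<cdot> a))"
      by (simp add: ring_rules algebra_simps)
    also have "\<dots> = D (a \<cdot> b \<cdot> a) + D (c \<cdot> b \<cdot> c) + D (a \<cdot> b \<cdot> c + c \<cdot> b \<cdot> a)"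
      using a b c by (simp add: add)
    finally have "D (a \<cdot> b \<cdot> c + c \<cdot> b \<cdot> a)
        = D ((a + c) \<cdot> b \<cdot> (a + c)) - D (a \<cdot> b \<cdot> a) - D (c \<cdot> b \<cdot> c)"
      by simp
    also have "\<dots> = D a \<cdot> b \<cdot> c + a \<cdot> D b \<cdot> c + a \<cdot> b \<cdot> D c + D c \<cdot> b \<cdot> a + c \<cdot> D b \<cdot> a + c \<cdot> b \<cdot> D a"
      using a b c by (simp only: triple add add_in) (simp add: ring_rules algebra_simps)
    finally show ?thesis .
  qed
  define \<theta> where "\<theta> a b = D (a \<cdot> b) - D a \<cdot> b - a \<cdot> D b" for a b
  have \<theta>_in: "\<theta> a b \<in> A" if "a \<in> A" "b \<in> A" for a b
    using that D unfolding \<theta>_def by simp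
  have \<theta>_add: "\<theta> a (b + c) = \<theta> a b + \<theta> a c" if "a \<in> A" "b \<in> A" "c \<in> A" for a b c
    using that unfolding \<theta>_def by (simp add: ring_rules add algebra_simps)
  have \<theta>_skew: "\<theta> b a = - \<theta> a b" if a: "a \<in> A" and b: "b \<in> A" for a b
    using jordan[OF a b] a b unfolding \<theta>_def by (simp add: add algebra_simps)
  have key: "\<theta> a b \<cdot> z \<cdot> (a \<cdot> b - b \<cdot> a) + (a \<cdot> b - b \<cdot> a) \<cdot> z \<cdot> \<theta> a b = 0"
    if a: "a \<in> A" and b: "b \<in> A" and z: "z \<in> A" for a b z
  proof -
    have ab: "D (a \<cdot> b) = D a \<cdot> b + a \<cdot> D b + \<theta> a b" unfolding \<theta>_def by simp
    have ba: "D (b \<cdot> a) = D b \<cdot> a + b \<cdot> D a - \<theta> a b"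
      using \<theta>_skew[OF a b] unfolding \<theta>_def by (simp add: algebra_simps)
    \<comment> \<open>on the left the linearised triple rule applies, on the right the triple rule, twice in each summand\<close>
    have "D ((a \<cdot> b) \<cdot> z \<cdot> (b \<cdot> a) + (b \<cdot> a) \<cdot> z \<cdot> (a \<cdot> b))
        = D (a \<cdot> (b \<cdot> z \<cdot> b) \<cdot> a + b \<cdot> (a \<cdot> z \<cdot> a) \<cdot> b)" by (simp add: ring_rules)
    also have "\<dots> = D (a \<cdot> (b \<cdot> z \<cdot> b) \<cdot> a) + D (b \<cdot> (a \<cdot> z \<cdot> a) \<cdot> b)"
      using a b z by (simp add: add)
    finally show ?thesis using a b z triple2[of "a \<cdot> b" z "b \<cdot> a"]
      by (simp only: triple mult_in D ab ba) (simp add: ring_rules algebra_simps)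
  qed
  have L: "\<theta> a b \<cdot> z \<cdot> (a \<cdot> b - b \<cdot> a) = 0" if "a \<in> A" "b \<in> A" "z \<in> A" for a b z
    by (rule skew_sandwich_zero) (use that \<theta>_in key in auto)
  have R: "(a \<cdot> b - b \<cdot> a) \<cdot> z \<cdot> \<theta> a b = 0" if "a \<in> A" "b \<in> A" "z \<in> A" for a b z
    using that L[OF that] key[OF that] by simp
  have lin: "\<theta> a b \<cdot> z \<cdot> (a \<cdot> c - c \<cdot> a) = 0"
    if a: "a \<in> A" and b: "b \<in> A" and c: "c \<in> A" and z: "z \<in> A" for a b c z
  proof (rule semiprime)
    show "\<theta> a b \<cdot> z \<cdot> (a \<cdot> c - c \<cdot> a) \<in> A" using that \<theta>_in by simp
    fix w assume w: "w \<in> A"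
    have "\<theta> a (b + c) \<cdot> z \<cdot> (a \<cdot> (b + c) - (b + c) \<cdot> a) = 0" using that by (intro L) auto
    then have "\<theta> a b \<cdot> z \<cdot> (a \<cdot> c - c \<cdot> a) = - (\<theta> a c \<cdot> z \<cdot> (a \<cdot> b - b \<cdot> a))"
      using L[OF a b z] L[OF a c z] that by (simp add: \<theta>_add ring_rules algebra_simps)
    from arg_cong[OF this, of "\<lambda>u. \<theta> a b \<cdot> z \<cdot> (a \<cdot> c - c \<cdot> a) \<cdot> w \<cdot> u"]
    have "\<theta> a b \<cdot> z \<cdot> (a \<cdot> c - c \<cdot> a) \<cdot> w \<cdot> (\<theta> a b \<cdot> z \<cdot> (a \<cdot> c - c \<cdot> a))
      = - (\<theta> a b \<cdot> z \<cdot> ((a \<cdot> c - c \<cdot> a) \<cdot> w \<cdot> \<theta> a c) \<cdot> z \<cdot> (a \<cdot> b - b \<cdot> a))"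
      by (simp only: assoc mult_minus)
    then show "\<theta> a b \<cdot> z \<cdot> (a \<cdot> c - c \<cdot> a) \<cdot> w \<cdot> (\<theta> a b \<cdot> z \<cdot> (a \<cdot> c - c \<cdot> a)) = 0"
      using R[OF a c w] by simp
  qed
  have noncentral: "\<theta> a b = 0" if a: "a \<in> A" and b: "b \<in> A" and nc: "\<not> central a" for a b
  proof -
    obtain c where c: "c \<in> A" "a \<cdot> c - c \<cdot> a \<noteq> 0" using nc unfolding central_def by auto
    with prime[of "\<theta> a b" "a \<cdot> c - c \<cdot> a"] lin[OF a b] \<theta>_in[OF a b] a show ?thesis by auto
  qed
  have "\<theta> x y = 0"
  proof (cases "central y")
    case False
    then show ?thesis using noncentral[of y x] \<theta>_skew[of x y] assms by simp
  next
    case True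
    obtain c where c: "c \<in> A" "\<not> central c" using noncomm by blast
    then have "\<not> central (y + c)"
      using True unfolding central_def by (auto simp: ring_rules)
    then have "\<theta> x (y + c) = 0" "\<theta> x c = 0"
      using noncentral[of "y + c" x] noncentral[of c x] \<theta>_skew[of x "y + c"] \<theta>_skew[of x c] c assms
      by simp_all
    then show ?thesis using \<theta>_add[of x y c] c assms by simp
  qed
  then show ?thesis unfolding \<theta>_def by (simp add: algebra_simps)
qed

section \<open>The normalised Jordan product and idempotents\<close>

definition jordan :: "'r \<Rightarrow> 'r \<Rightarrow> 'r" (infixl "\<odot>" 70) where
  "x \<odot> y = (1/2) *\<^sub>R (x \<cdot> y + y \<cdot> x)"

lemma jordan_in [simp]: "\<lbrakk>x \<in> A; y \<in> A\<rbrakk> \<Longrightarrow> x \<odot> y \<in> A"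
  by (simp add: jordan_def)

lemma half_add_half: "(1/2) *\<^sub>R x + (1/2) *\<^sub>R x = (x::'r)"
  by (simp flip: scaleR_left_distrib)

lemma jordan_double: "x \<cdot> y + y \<cdot> x = x \<odot> y + x \<odot> y"
  by (simp only: jordan_def half_add_half)

lemma jordan_commute: "x \<odot> y = y \<odot> x"
  by (simp add: jordan_def add.commute)

lemma unit_jordan [simp]: "\<one> \<odot> x = x" "x \<odot> \<one> = x"
  by (simp_all add: jordan_def half_add_half scaleR_right_distrib)

lemma zero_jordan [simp]: "0 \<odot> x = 0" "x \<odot> 0 = 0"
  by (simp_all add: jordan_def)

lemma jordan_bilinear:
  "(x + y) \<odot> z = x \<odot> z + y \<odot> z" "z \<odot> (x + y) = z \<odot> x + z \<odot> y"
  "(x - y) \<odot> z = x \<odot> z - y \<odot> z" "z \<odot> (x - y) = z \<odot> x - z \<odot> y"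
  "(r *\<^sub>R x) \<odot> z = r *\<^sub>R (x \<odot> z)" "z \<odot> (r *\<^sub>R x) = r *\<^sub>R (z \<odot> x)"
  by (simp_all add: jordan_def ring_rules algebra_simps)

lemma jordan_idem: "p \<cdot> p = p \<Longrightarrow> p \<odot> p = p"
  by (simp add: jordan_def half_add_half scaleR_right_distrib)

definition nontrivial_idempotent :: "'r \<Rightarrow> bool" where
  "nontrivial_idempotent e \<longleftrightarrow> e \<in> A \<and> e \<cdot> e = e \<and> e \<noteq> 0 \<and> e \<noteq> \<one>"

lemma nontrivial_idempotentD:
  assumes "nontrivial_idempotent e"
  shows "e \<in> A" "e \<cdot> e = e" "e \<cdot> (e \<cdot> x) = e \<cdot> x" "e \<noteq> 0" "e \<noteq> \<one>"
  using assms assoc[of e e x] by (simp_all add: nontrivial_idempotent_def)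

lemma nontrivial_idempotent_complement:
  "nontrivial_idempotent e \<Longrightarrow> nontrivial_idempotent (\<one> - e)"
  by (auto simp: nontrivial_idempotent_def ring_rules)

lemma not_commutative:
  assumes "nontrivial_idempotent e"
  shows "\<not> (\<forall>x\<in>A. central x)"
proof
  note e = nontrivial_idempotentD[OF assms]
  assume "\<forall>x\<in>A. central x"
  then have "e \<cdot> x \<cdot> (\<one> - e) = 0" if "x \<in> A" for x
    using that e by (simp add: central_def ring_rules)
  then show False using prime[of e "\<one> - e"] e by auto
qed

text \<open>With \<open>e\<close> also \<open>e + e x (1 - e)\<close> is idempotent, so \<open>c\<close> commutes with the whole corner
  \<open>e A (1 - e)\<close>, and \<open>e [c, y] (1 - e) = [c, e y (1 - e)] = 0\<close>. As \<open>e y e x (1 - e)\<close> lies in this corner for every \<open>x\<close>, primeness gives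
  \<open>e [c, y] = 0\<close>; the same holds for \<open>1 - e\<close>.\<close>

lemma commutes_with_idempotents_central:
  assumes ex: "nontrivial_idempotent e" and c: "c \<in> A"
    and comm: "\<And>p. \<lbrakk>p \<in> A; p \<cdot> p = p\<rbrakk> \<Longrightarrow> c \<cdot> p = p \<cdot> c"
  shows "central c"
proof -
  have corner: "e \<cdot> (c \<cdot> y - y \<cdot> c) = 0" if ex: "nontrivial_idempotent e" and y: "y \<in> A" for e y
  proof -
    note e = nontrivial_idempotentD[OF ex]
    have ce: "c \<cdot> e = e \<cdot> c" using comm e by simp
    have ce': "c \<cdot> (e \<cdot> x) = e \<cdot> (c \<cdot> x)" for x using ce by (simp flip: assoc)
    have off: "c \<cdot> (e \<cdot> x \<cdot> (\<one> - e)) = e \<cdot> x \<cdot> (\<one> - e) \<cdot> c" if x: "x \<in> A" for x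
    proof -
      have "(e + e \<cdot> x \<cdot> (\<one> - e)) \<cdot> (e + e \<cdot> x \<cdot> (\<one> - e)) = e + e \<cdot> x \<cdot> (\<one> - e)"
        using e by (simp add: ring_rules algebra_simps)
      then have "c \<cdot> (e + e \<cdot> x \<cdot> (\<one> - e)) = (e + e \<cdot> x \<cdot> (\<one> - e)) \<cdot> c"
        using e x by (intro comm) auto
      then show ?thesis using ce by (simp add: ring_rules)
    qed
    have cut: "e \<cdot> (c \<cdot> y - y \<cdot> c) \<cdot> (\<one> - e) = 0"
    proof -
      have "e \<cdot> (c \<cdot> y - y \<cdot> c) \<cdot> (\<one> - e) = c \<cdot> (e \<cdot> y \<cdot> (\<one> - e)) - e \<cdot> y \<cdot> (\<one> - e) \<cdot> c"
        using ce ce' by (simp add: ring_rules)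
      then show ?thesis using off[OF y] by simp
    qed
    have "e \<cdot> (c \<cdot> y - y \<cdot> c) \<cdot> x \<cdot> (\<one> - e) = 0" if x: "x \<in> A" for x
    proof -
      have "e \<cdot> (c \<cdot> y - y \<cdot> c) \<cdot> x \<cdot> (\<one> - e)
        = e \<cdot> (c \<cdot> y - y \<cdot> c) \<cdot> e \<cdot> x \<cdot> (\<one> - e) + e \<cdot> (c \<cdot> y - y \<cdot> c) \<cdot> (\<one> - e) \<cdot> x \<cdot> (\<one> - e)"
        by (simp add: ring_rules)
      also have "\<dots> = e \<cdot> (c \<cdot> y - y \<cdot> c) \<cdot> e \<cdot> x \<cdot> (\<one> - e)" using cut by simp
      also have "\<dots> = c \<cdot> (e \<cdot> (y \<cdot> e \<cdot> x) \<cdot> (\<one> - e)) - e \<cdot> y \<cdot> (c \<cdot> (e \<cdot> x \<cdot> (\<one> - e)))"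
        using ce' by (simp add: ring_rules)
      also have "\<dots> = 0"
        using off[of "y \<cdot> e \<cdot> x"] off[of x] e x y by (simp add: assoc)
      finally show ?thesis .
    qed
    then show ?thesis using prime[of "e \<cdot> (c \<cdot> y - y \<cdot> c)" "\<one> - e"] e c y by auto
  qed
  show ?thesis unfolding central_def
  proof
    fix y assume y: "y \<in> A"
    have "c \<cdot> y - y \<cdot> c = e \<cdot> (c \<cdot> y - y \<cdot> c) + (\<one> - e) \<cdot> (c \<cdot> y - y \<cdot> c)" by (simp add: ring_rules)
    also have "\<dots> = 0" using corner[OF _ y] ex nontrivial_idempotent_complement by simp
    finally show "c \<cdot> y = y \<cdot> c" by simp
  qed
qed

section \<open>Peirce decomposition\<close>

text \<open>The eigenspaces of \<open>x \<mapsto> e \<odot> x\<close> for the eigenvalues \<open>1\<close> and \<open>1/2\<close>: the corner \<open>e A e\<close> and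
  \<open>e A (1 - e) + (1 - e) A e\<close>. The eigenspace for \<open>0\<close> is the corner \<open>peirce_one (1 - e)\<close>, so that
  every fact about one corner yields a fact about the other. Describing the components through \<open>\<odot>\<close>
  makes them visible to maps that respect only this product.\<close>

definition peirce_one :: "'r \<Rightarrow> 'r set" where
  "peirce_one e = {x \<in> A. e \<odot> x = x}"

definition peirce_half :: "'r \<Rightarrow> 'r set" where
  "peirce_half e = {x \<in> A. e \<odot> x = (1/2) *\<^sub>R x}"

definition off_diagonal :: "'r \<Rightarrow> 'r \<Rightarrow> 'r" where
  "off_diagonal e x = e \<cdot> x \<cdot> (\<one> - e) + (\<one> - e) \<cdot> x \<cdot> e"

lemma peirce_half_complement: "peirce_half (\<one> - e) = peirce_half e"
proof -
  have "x - y = (1/2) *\<^sub>R x \<longleftrightarrow> y = (1/2) *\<^sub>R x" for x y :: 'r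
    using half_add_half[of x] by (metis add_diff_cancel_left' diff_add_cancel)
  then show ?thesis by (simp add: peirce_half_def jordan_bilinear)
qed

lemma off_diagonal_complement: "off_diagonal (\<one> - e) x = off_diagonal e x"
  by (simp add: off_diagonal_def)

lemma off_diagonal_linear:
  "off_diagonal e (x + y) = off_diagonal e x + off_diagonal e y"
  "off_diagonal e (r *\<^sub>R x) = r *\<^sub>R off_diagonal e x"
  by (simp_all add: off_diagonal_def ring_rules algebra_simps)

text \<open>As rewrite rules these equations move every \<open>e\<close> to the left, which decides the identities
  between Peirce components below.\<close>

lemma peirce_half_mult:
  assumes "x \<in> peirce_half e"
  shows "x \<cdot> e = x - e \<cdot> x" "x \<cdot> (e \<cdot> y) = x \<cdot> y - e \<cdot> (x \<cdot> y)"
proof -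
  have "(1/2) *\<^sub>R (e \<cdot> x + x \<cdot> e) = (1/2) *\<^sub>R x"
    using assms by (simp add: peirce_half_def jordan_def)
  then have "e \<cdot> x + x \<cdot> e = x" by (simp only: scaleR_cancel_left) simp
  then show *: "x \<cdot> e = x - e \<cdot> x" by (simp add: algebra_simps)
  show "x \<cdot> (e \<cdot> y) = x \<cdot> y - e \<cdot> (x \<cdot> y)"
    using arg_cong[OF *, of "\<lambda>u. u \<cdot> y"] by (simp add: ring_rules)
qed

lemma peirce_halfI: "\<lbrakk>x \<in> A; e \<cdot> x + x \<cdot> e = x\<rbrakk> \<Longrightarrow> x \<in> peirce_half e"
  by (simp add: peirce_half_def jordan_def)

lemma peirce_one_mult:
  assumes ex: "nontrivial_idempotent e" and x: "x \<in> peirce_one e"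
  shows "e \<cdot> x = x" "x \<cdot> e = x" "x \<cdot> (e \<cdot> y) = x \<cdot> y"
proof -
  note e = nontrivial_idempotentD[OF ex]
  have *: "e \<cdot> x + x \<cdot> e = x + x"
  proof -
    have "(1/2) *\<^sub>R (e \<cdot> x + x \<cdot> e) = (1/2) *\<^sub>R (x + x)"
      using x half_add_half[of x] by (simp add: peirce_one_def jordan_def scaleR_right_distrib)
    then show ?thesis by (simp only: scaleR_cancel_left) simp
  qed
  have "e \<cdot> (x \<cdot> e) = e \<cdot> x" "e \<cdot> (x \<cdot> e) = x \<cdot> e"
    using arg_cong[OF *, of "\<lambda>u. e \<cdot> u"] arg_cong[OF *, of "\<lambda>u. u \<cdot> e"] e by (simp_all add: ring_rules)
  with * show "e \<cdot> x = x" and xe: "x \<cdot> e = x"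
    using double_cancel[of "e \<cdot> x" x] by simp_all
  show "x \<cdot> (e \<cdot> y) = x \<cdot> y" using xe by (simp flip: assoc)
qed

lemma peirce_oneI: "\<lbrakk>x \<in> A; e \<cdot> x = x; x \<cdot> e = x\<rbrakk> \<Longrightarrow> x \<in> peirce_one e"
  by (simp add: peirce_one_def jordan_def scaleR_right_distrib half_add_half)

lemma peirce_parts:
  assumes ex: "nontrivial_idempotent e" and x: "x \<in> A"
  shows "e \<cdot> x \<cdot> e \<in> peirce_one e" "off_diagonal e x \<in> peirce_half e"
    "e \<odot> x = e \<cdot> x \<cdot> e + (1/2) *\<^sub>R off_diagonal e x"
    "x = e \<cdot> x \<cdot> e + off_diagonal e x + (\<one> - e) \<cdot> x \<cdot> (\<one> - e)"
    "e \<odot> ((\<one> - e) \<odot> x) = (1/4) *\<^sub>R off_diagonal e x"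
proof -
  note e = nontrivial_idempotentD[OF ex]
  show "e \<cdot> x \<cdot> e \<in> peirce_one e" using e x by (intro peirce_oneI) (simp_all add: ring_rules)
  show "off_diagonal e x \<in> peirce_half e"
    using e x by (intro peirce_halfI) (simp_all add: off_diagonal_def ring_rules)
  show "x = e \<cdot> x \<cdot> e + off_diagonal e x + (\<one> - e) \<cdot> x \<cdot> (\<one> - e)"
    by (simp add: off_diagonal_def ring_rules)
  show "e \<odot> x = e \<cdot> x \<cdot> e + (1/2) *\<^sub>R off_diagonal e x"
    using half_add_half[of "e \<cdot> (x \<cdot> e)"]
    by (simp add: off_diagonal_def jordan_def ring_rules algebra_simps)
  show "e \<odot> ((\<one> - e) \<odot> x) = (1/4) *\<^sub>R off_diagonal e x"
    using half_add_half[of "e \<cdot> x"] half_add_half[of "x \<cdot> e"] e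
    by (simp add: off_diagonal_def jordan_def ring_rules flip: scaleR_right_distrib scaleR_right_diff_distrib)
qed

lemma peirce_half_one_in_half:
  assumes ex: "nontrivial_idempotent e" and "k \<in> peirce_half e" "a \<in> peirce_one e"
  shows "k \<odot> a \<in> peirce_half e"
proof (rule peirce_halfI)
  show "k \<odot> a \<in> A" using assms by (simp add: peirce_half_def peirce_one_def)
  have ea: "e \<cdot> (a \<cdot> x) = a \<cdot> x" for x
    using peirce_one_mult(1)[OF ex assms(3)] by (simp flip: assoc)
  have "e \<cdot> (k \<cdot> a) = 0"
    using peirce_half_mult(2)[OF assms(2), of a] peirce_one_mult(1)[OF ex assms(3)] by simp
  then show "e \<cdot> (k \<odot> a) + k \<odot> a \<cdot> e = k \<odot> a"
    using peirce_one_mult[OF ex assms(3)] peirce_half_mult[OF assms(2)] ea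
    by (simp add: jordan_def ring_rules flip: scaleR_right_distrib)
qed

lemma off_diagonal_half:
  assumes ex: "nontrivial_idempotent e" and "k \<in> peirce_half e"
  shows "off_diagonal e k = k"
  using nontrivial_idempotentD[OF ex] peirce_half_mult[OF assms(2)]
  by (simp add: off_diagonal_def ring_rules)

lemma off_diagonal_half_half:
  assumes ex: "nontrivial_idempotent e" and "k \<in> peirce_half e" "h \<in> peirce_half e"
  shows "off_diagonal e (k \<odot> h) = 0"
  using nontrivial_idempotentD[OF ex] peirce_half_mult[OF assms(2)] peirce_half_mult[OF assms(3)]
  by (simp add: off_diagonal_def jordan_def ring_rules)

lemma off_diagonal_jordan:
  assumes "nontrivial_idempotent e" "k \<in> peirce_half e" "a \<in> peirce_one e" "h \<in> peirce_half e"
  shows "off_diagonal e (k \<odot> (a + h)) = k \<odot> a"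
  using assms
  by (simp add: jordan_bilinear off_diagonal_linear off_diagonal_half_half off_diagonal_half peirce_half_one_in_half)

text \<open>The elements \<open>h = e a (1 - e)\<close> satisfy \<open>2 (h \<odot> z) = z a (1 - e)\<close>, so primeness applies.
  This is how identities are verified on a corner: by multiplying into the off-diagonal part.\<close>

lemma peirce_one_eq_zero:
  assumes ex: "nontrivial_idempotent e" and z: "z \<in> peirce_one e"
    and kill: "\<And>h. h \<in> peirce_half e \<Longrightarrow> h \<odot> z = 0"
  shows "z = 0"
proof -
  note e = nontrivial_idempotentD[OF ex]
  note ez = peirce_one_mult[OF ex z]
  have zA: "z \<in> A" using z by (simp add: peirce_one_def)
  have "z \<cdot> a \<cdot> (\<one> - e) = 0" if a: "a \<in> A" for a
  proof -
    have "e \<cdot> a \<cdot> (\<one> - e) \<in> peirce_half e"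
      using e a by (intro peirce_halfI) (simp_all add: ring_rules)
    from kill[OF this] show ?thesis using ez e by (simp add: jordan_def ring_rules)
  qed
  then show ?thesis using prime[OF zA, of "\<one> - e"] e by auto
qed

section \<open>Additivity of multiplicative Jordan derivations\<close>

definition jordan_leibniz :: "('r \<Rightarrow> 'r) \<Rightarrow> bool" where
  "jordan_leibniz D \<longleftrightarrow> (\<forall>x\<in>A. D x \<in> A) \<and>
    (\<forall>x\<in>A. \<forall>y\<in>A. D (x \<odot> y) = D x \<odot> y + x \<odot> D y)"

context
  fixes D
  assumes D: "jordan_leibniz D"
begin

lemma D_in: "x \<in> A \<Longrightarrow> D x \<in> A"
  using D by (simp add: jordan_leibniz_def)

lemma D_jordan: "\<lbrakk>x \<in> A; y \<in> A\<rbrakk> \<Longrightarrow> D (x \<odot> y) = D x \<odot> y + x \<odot> D y"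
  using D by (simp add: jordan_leibniz_def)

lemma D_zero: "D 0 = 0"
  using D_jordan[of 0 0] by simp

lemma D_complement:
  assumes ex: "nontrivial_idempotent e" and De: "D e = 0"
  shows "D (\<one> - e) = 0"
proof -
  note e = nontrivial_idempotentD[OF ex]
  have f: "\<one> - e \<in> A" using e by simp
  have "e \<odot> (\<one> - e) = 0" using jordan_idem e by (simp add: jordan_bilinear)
  then have *: "e \<odot> D (\<one> - e) = 0"
    using D_jordan[OF e(1) f] De D_zero by simp
  then have fixed: "(\<one> - e) \<odot> D (\<one> - e) = D (\<one> - e)" by (simp add: jordan_bilinear(3))
  have "(\<one> - e) \<odot> (\<one> - e) = \<one> - e"
    using nontrivial_idempotentD(2)[OF nontrivial_idempotent_complement[OF ex]] by (rule jordan_idem)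
  with D_jordan[OF f f] have "D (\<one> - e) = D (\<one> - e) + D (\<one> - e)"
    by (simp only: fixed jordan_commute[of "D (\<one> - e)"])
  then show ?thesis by simp
qed

text \<open>Since \<open>D\<close> commutes with multiplication by \<open>e\<close> and by \<open>1 - e\<close>, it maps eigenvectors to
  eigenvectors with the same eigenvalue. On the off-diagonal part both multiplications are division by \<open>2\<close>, so
  \<open>D (x/2)\<close> is both \<open>e \<odot> D x\<close> and \<open>(1 - e) \<odot> D x\<close>, and hence half of their sum \<open>D x\<close>.\<close>

lemma D_peirce:
  assumes ex: "nontrivial_idempotent e" and De: "D e = 0"
  shows D_idem_jordan: "x \<in> A \<Longrightarrow> D (e \<odot> x) = e \<odot> D x"
    and D_peirce_one: "x \<in> peirce_one e \<Longrightarrow> D x \<in> peirce_one e"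
    and D_peirce_half: "x \<in> peirce_half e \<Longrightarrow> D x \<in> peirce_half e"
    and D_half: "x \<in> peirce_half e \<Longrightarrow> D ((1/2) *\<^sub>R x) = (1/2) *\<^sub>R D x"
    and D_off_diagonal: "x \<in> A \<Longrightarrow> D (off_diagonal e x) = off_diagonal e (D x)"
proof -
  note e = nontrivial_idempotentD[OF ex]
  have f: "\<one> - e \<in> A" and Df: "D (\<one> - e) = 0" using e D_complement[OF ex De] by auto
  show comm: "D (e \<odot> x) = e \<odot> D x" if "x \<in> A" for x
    using D_jordan[OF e(1) that] De by simp
  have commf: "D ((\<one> - e) \<odot> x) = (\<one> - e) \<odot> D x" if "x \<in> A" for x
    using D_jordan[OF f that] Df by simp
  show "D x \<in> peirce_one e" if "x \<in> peirce_one e" for x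
    using that comm[of x] D_in[of x] by (simp add: peirce_one_def)
  have half: "e \<odot> D x = (1/2) *\<^sub>R D x \<and> D ((1/2) *\<^sub>R x) = (1/2) *\<^sub>R D x" if x: "x \<in> peirce_half e" for x
  proof -
    have xA: "x \<in> A" using x by (simp add: peirce_half_def)
    have 1: "D ((1/2) *\<^sub>R x) = e \<odot> D x"
      using x comm[OF xA] by (simp add: peirce_half_def)
    have "x \<in> peirce_half (\<one> - e)" using x by (simp add: peirce_half_complement)
    then have 2: "D ((1/2) *\<^sub>R x) = (\<one> - e) \<odot> D x"
      using commf[OF xA] unfolding peirce_half_def by simp
    have "D x - e \<odot> D x = e \<odot> D x" using 1 2 by (simp add: jordan_bilinear(3))
    then have "e \<odot> D x + e \<odot> D x = D x" by (metis diff_add_cancel)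
    then have "e \<odot> D x = (1/2) *\<^sub>R D x"
      using half_add_half[of "D x"] double_cancel by metis
    then show ?thesis using 1 by simp
  qed
  show halfI: "D x \<in> peirce_half e" if "x \<in> peirce_half e" for x
    using that half[OF that] D_in[of x] by (simp add: peirce_half_def)
  show D2: "D ((1/2) *\<^sub>R x) = (1/2) *\<^sub>R D x" if "x \<in> peirce_half e" for x
    using half[OF that] by simp
  show "D (off_diagonal e x) = off_diagonal e (D x)" if x: "x \<in> A" for x
  proof -
    have o: "off_diagonal e x \<in> peirce_half e" using peirce_parts(2)[OF ex x] .
    then have h2: "(1/2) *\<^sub>R off_diagonal e x \<in> peirce_half e"
      by (simp add: peirce_half_def jordan_bilinear)
    have "D ((1/2) *\<^sub>R (1/2) *\<^sub>R off_diagonal e x) = (1/2) *\<^sub>R (1/2) *\<^sub>R D (off_diagonal e x)"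
      by (simp only: D2[OF h2] D2[OF o])
    then have "(1/4) *\<^sub>R D (off_diagonal e x) = D (e \<odot> ((\<one> - e) \<odot> x))"
      using peirce_parts(5)[OF ex x] by simp
    also have "\<dots> = e \<odot> ((\<one> - e) \<odot> D x)"
      using comm[of "(\<one> - e) \<odot> x"] commf[OF x] x f by simp
    also have "\<dots> = (1/4) *\<^sub>R off_diagonal e (D x)"
      using peirce_parts(5)[OF ex D_in[OF x]] .
    finally show ?thesis by simp
  qed
qed

text \<open>Multiplication by \<open>1 - e\<close> removes \<open>a\<close>, so the defect \<open>z\<close> lies in the corner of \<open>e\<close>. For
  off-diagonal \<open>k\<close> the off-diagonal part of \<open>k \<odot> (a + h)\<close> is just \<open>k \<odot> a\<close>; computing \<open>D\<close> of it
  in two ways gives \<open>k \<odot> z = 0\<close>.\<close>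

lemma D_one_plus_half:
  assumes ex: "nontrivial_idempotent e" and De: "D e = 0"
    and a: "a \<in> peirce_one e" and h: "h \<in> peirce_half e"
  shows "D (a + h) = D a + D h"
proof -
  note e = nontrivial_idempotentD[OF ex]
  note fx = nontrivial_idempotent_complement[OF ex]
  note Df = D_complement[OF ex De]
  have in_A: "a \<in> A" "h \<in> A" "D a \<in> A" "D h \<in> A" "D (a + h) \<in> A" "\<one> - e \<in> A"
    using a h e D_in by (auto simp: peirce_one_def peirce_half_def)
  have Da: "D a \<in> peirce_one e" and Dh: "D h \<in> peirce_half e"
    using D_peirce[OF ex De] a h by auto
  define z where "z = D (a + h) - D a - D h"
  have Dw: "D (a + h) = (z + D a) + D h" by (simp add: z_def)
  have zA: "z \<in> A" using in_A by (simp add: z_def)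
  have fhalf: "(\<one> - e) \<odot> x = (1/2) *\<^sub>R x" if "x \<in> peirce_half e" for x
    using that peirce_half_complement[of e] by (auto simp: peirce_half_def)
  have fone: "(\<one> - e) \<odot> x = 0" if "x \<in> peirce_one e" for x
    using that by (simp add: peirce_one_def jordan_bilinear)
  have "(\<one> - e) \<odot> D (a + h) = D ((\<one> - e) \<odot> (a + h))"
    using D_idem_jordan[OF fx Df] in_A by simp
  also have "(\<one> - e) \<odot> (a + h) = (1/2) *\<^sub>R h"
    by (simp only: jordan_bilinear(2) fhalf[OF h] fone[OF a]) simp
  also have "D \<dots> = (1/2) *\<^sub>R D h" using D_half[OF ex De h] .
  finally have "(\<one> - e) \<odot> z = 0"
    by (simp only: z_def jordan_bilinear(4) fhalf[OF Dh] fone[OF Da]) simp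
  then have z1: "z \<in> peirce_one e" using zA by (simp add: peirce_one_def jordan_bilinear)
  then have zDa: "z + D a \<in> peirce_one e" using Da by (simp add: peirce_one_def jordan_bilinear)
  have "z = 0"
  proof (rule peirce_one_eq_zero[OF ex z1])
    fix k assume k: "k \<in> peirce_half e"
    then have kA: "k \<in> A" and Dk: "D k \<in> peirce_half e"
      using D_peirce[OF ex De] by (auto simp: peirce_half_def)
    have "D k \<odot> a + k \<odot> D a = D (off_diagonal e (k \<odot> (a + h)))"
      using off_diagonal_jordan[OF ex k a h] D_jordan[OF kA in_A(1)] by simp
    also have "\<dots> = off_diagonal e (D k \<odot> (a + h)) + off_diagonal e (k \<odot> ((z + D a) + D h))"
      using D_off_diagonal[OF ex De] D_jordan kA in_A by (simp add: off_diagonal_linear Dw)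
    also have "\<dots> = D k \<odot> a + k \<odot> (z + D a)"
      using off_diagonal_jordan[OF ex Dk a h] off_diagonal_jordan[OF ex k zDa Dh] by simp
    finally show "k \<odot> z = 0" by (simp add: jordan_bilinear)
  qed
  then show ?thesis using Dw by simp
qed

text \<open>The previous lemma, for \<open>e\<close> and for \<open>1 - e\<close>, computes both summands of
  \<open>D x = e \<odot> D x + (1 - e) \<odot> D x\<close>.\<close>

lemma D_parts:
  assumes ex: "nontrivial_idempotent e" and De: "D e = 0" and x: "x \<in> A"
  shows "D x = D (e \<cdot> x \<cdot> e) + D (off_diagonal e x) + D ((\<one> - e) \<cdot> x \<cdot> (\<one> - e))"
proof -
  have step: "e \<odot> D x = D (e \<cdot> x \<cdot> e) + (1/2) *\<^sub>R D (off_diagonal e x)"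
    if ex: "nontrivial_idempotent e" and De: "D e = 0" for e
  proof -
    note p = peirce_parts[OF ex x]
    have "(1/2) *\<^sub>R off_diagonal e x \<in> peirce_half e"
      using p(2) by (simp add: peirce_half_def jordan_bilinear)
    then have "D (e \<cdot> x \<cdot> e + (1/2) *\<^sub>R off_diagonal e x)
        = D (e \<cdot> x \<cdot> e) + (1/2) *\<^sub>R D (off_diagonal e x)"
      using D_one_plus_half[OF ex De p(1)] D_half[OF ex De p(2)] by simp
    then show ?thesis using D_idem_jordan[OF ex De x] p(3) by simp
  qed
  have "D x = e \<odot> D x + (\<one> - e) \<odot> D x" by (simp add: jordan_bilinear)
  then show ?thesis
    using step[OF ex De] step[OF nontrivial_idempotent_complement[OF ex] D_complement[OF ex De]]
      half_add_half[of "D (off_diagonal e x)"]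
    by (simp add: off_diagonal_complement algebra_simps)
qed

text \<open>The product \<open>(e + a) \<odot> ((1 - e) + b)\<close> has off-diagonal part \<open>(a + b)/2\<close>: the Leibniz rule
  for this product turns into additivity.\<close>

lemma D_half_plus_half:
  assumes ex: "nontrivial_idempotent e" and De: "D e = 0"
    and a: "a \<in> peirce_half e" and b: "b \<in> peirce_half e"
  shows "D (a + b) = D a + D b"
proof -
  note e = nontrivial_idempotentD[OF ex]
  note fx = nontrivial_idempotent_complement[OF ex]
  note Df = D_complement[OF ex De]
  let ?f = "\<one> - e"
  have e1: "e \<in> peirce_one e" and f1: "?f \<in> peirce_one ?f"
    using e nontrivial_idempotentD[OF fx] by (auto intro!: peirce_oneI)
  have b': "b \<in> peirce_half ?f" and a': "a \<in> peirce_half ?f"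
    using a b by (simp_all add: peirce_half_complement)
  have in_A: "a \<in> A" "b \<in> A" "?f \<in> A" using a b e by (auto simp: peirce_half_def)
  have D1: "D (e + a) = D a" using D_one_plus_half[OF ex De e1 a] De by simp
  have D2: "D (?f + b) = D b" using D_one_plus_half[OF fx Df f1 b'] Df by simp
  have ab: "a + b \<in> peirce_half e" using a b by (simp add: peirce_half_def jordan_bilinear scaleR_right_distrib)
  have Da: "D a \<in> peirce_half e" and Db: "D b \<in> peirce_half e" using D_peirce[OF ex De] a b by auto
  then have Da': "D a \<in> peirce_half ?f" by (simp add: peirce_half_complement)
  have half: "x \<odot> ?f = (1/2) *\<^sub>R x" "x \<odot> e = (1/2) *\<^sub>R x" if "x \<in> peirce_half e" for x
    using that peirce_half_complement[of e] jordan_commute[of x] by (auto simp: peirce_half_def)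
  have off: "off_diagonal e (x \<odot> (?f + y)) = (1/2) *\<^sub>R x" "off_diagonal e ((e + y) \<odot> x) = (1/2) *\<^sub>R x"
    if "x \<in> peirce_half e" "y \<in> peirce_half e" for x y
    using off_diagonal_jordan[OF fx _ f1, of x y] off_diagonal_jordan[OF ex _ e1, of x y] that half
    by (simp_all add: peirce_half_complement off_diagonal_complement jordan_commute[of "e + y"])
  have "off_diagonal e ((e + a) \<odot> (?f + b)) = (1/2) *\<^sub>R (a + b)"
  proof -
    have "(e + a) \<odot> (?f + b) = e \<odot> ?f + a \<odot> (?f + b) + e \<odot> b"
      by (simp only: jordan_bilinear(1,2) add_ac)
    moreover have "e \<odot> ?f = 0" using jordan_idem e by (simp add: jordan_bilinear)
    moreover have "e \<odot> b = (1/2) *\<^sub>R b" using b by (simp add: peirce_half_def)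
    ultimately show ?thesis using off(1)[OF a b] off_diagonal_half[OF ex b]
      by (simp add: off_diagonal_linear scaleR_right_distrib)
  qed
  then have "(1/2) *\<^sub>R D (a + b) = D (off_diagonal e ((e + a) \<odot> (?f + b)))"
    using D_half[OF ex De ab] by simp
  also have "\<dots> = off_diagonal e (D ((e + a) \<odot> (?f + b)))"
    using D_off_diagonal[OF ex De] in_A e by simp
  also have "\<dots> = off_diagonal e (D a \<odot> (?f + b)) + off_diagonal e ((e + a) \<odot> D b)"
    using D_jordan[of "e + a" "?f + b"] D1 D2 in_A e by (simp add: off_diagonal_linear)
  also have "\<dots> = (1/2) *\<^sub>R (D a + D b)"
    using off(1)[OF Da b] off(2)[OF Db a] by (simp add: scaleR_right_distrib)
  finally show ?thesis by simp
qed

text \<open>For off-diagonal \<open>h\<close> the products \<open>h \<odot> a\<close> and \<open>h \<odot> b\<close> are off-diagonal, where additivity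
  is known.\<close>

lemma D_one_plus_one:
  assumes ex: "nontrivial_idempotent e" and De: "D e = 0"
    and a: "a \<in> peirce_one e" and b: "b \<in> peirce_one e"
  shows "D (a + b) = D a + D b"
proof -
  have in_A: "a \<in> A" "b \<in> A" using a b by (auto simp: peirce_one_def)
  have "a + b \<in> peirce_one e" using a b by (simp add: peirce_one_def jordan_bilinear)
  then have z: "D (a + b) - D a - D b \<in> peirce_one e"
    using D_peirce_one[OF ex De, of "a + b"] D_peirce_one[OF ex De a] D_peirce_one[OF ex De b]
    by (simp add: peirce_one_def jordan_bilinear)
  have "D (a + b) - D a - D b = 0"
  proof (rule peirce_one_eq_zero[OF ex z])
    fix h assume h: "h \<in> peirce_half e"
    then have hA: "h \<in> A" by (simp add: peirce_half_def)
    have "D h \<odot> (a + b) + h \<odot> D (a + b) = D (h \<odot> a + h \<odot> b)"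
      using D_jordan[of h "a + b"] hA in_A by (simp add: jordan_bilinear)
    also have "\<dots> = D h \<odot> a + h \<odot> D a + (D h \<odot> b + h \<odot> D b)"
      using D_half_plus_half[OF ex De peirce_half_one_in_half[OF ex h a] peirce_half_one_in_half[OF ex h b]]
        D_jordan hA in_A by simp
    finally show "h \<odot> (D (a + b) - D a - D b) = 0" by (simp add: jordan_bilinear algebra_simps)
  qed
  then show ?thesis by (simp add: algebra_simps)
qed

lemma additive_if_kills_idempotent:
  assumes ex: "nontrivial_idempotent e" and De: "D e = 0" and x: "x \<in> A" and y: "y \<in> A"
  shows "D (x + y) = D x + D y"
proof -
  note fx = nontrivial_idempotent_complement[OF ex]
  note Df = D_complement[OF ex De]
  have sum: "u \<cdot> (x + y) \<cdot> u = u \<cdot> x \<cdot> u + u \<cdot> y \<cdot> u" for u by (simp add: ring_rules)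
  show ?thesis
    unfolding D_parts[OF ex De add_in[OF x y]] D_parts[OF ex De x] D_parts[OF ex De y]
      sum off_diagonal_linear
      D_one_plus_one[OF ex De peirce_parts(1)[OF ex x] peirce_parts(1)[OF ex y]]
      D_one_plus_one[OF fx Df peirce_parts(1)[OF fx x] peirce_parts(1)[OF fx y]]
      D_half_plus_half[OF ex De peirce_parts(2)[OF ex x] peirce_parts(2)[OF ex y]]
    by (simp add: algebra_simps)
qed

end

text \<open>The rule for \<open>e \<odot> e = e\<close> makes \<open>D e\<close> off-diagonal. Then \<open>u = D e e - e D e\<close> satisfies
  \<open>u e - e u = D e\<close>, and subtracting the inner derivation of \<open>u\<close> reduces to the case \<open>D e = 0\<close>.\<close>

theorem jordan_leibniz_additive:
  assumes D: "jordan_leibniz D" and ex: "nontrivial_idempotent e"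
    and x: "x \<in> A" and y: "y \<in> A"
  shows "D (x + y) = D x + D y"
proof -
  note e = nontrivial_idempotentD[OF ex]
  have De_in: "D e \<in> A" using D_in[OF D e(1)] .
  define u where "u = D e \<cdot> e - e \<cdot> D e"
  have uA: "u \<in> A" using De_in e by (simp add: u_def)
  define D' where "D' x = D x - (u \<cdot> x - x \<cdot> u)" for x
  have D': "jordan_leibniz D'"
    unfolding jordan_leibniz_def
  proof (intro conjI ballI)
    fix x y assume xy: "x \<in> A" "y \<in> A"
    show "D' x \<in> A" using D_in[OF D] xy uA by (simp add: D'_def)
    have "u \<cdot> (x \<odot> y) - (x \<odot> y) \<cdot> u = (u \<cdot> x - x \<cdot> u) \<odot> y + x \<odot> (u \<cdot> y - y \<cdot> u)"
      by (simp add: jordan_def ring_rules algebra_simps)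
    then show "D' (x \<odot> y) = D' x \<odot> y + x \<odot> D' y"
      using D_jordan[OF D xy] by (simp add: D'_def jordan_bilinear)
  qed
  have De: "e \<cdot> D e + D e \<cdot> e = D e"
  proof -
    have "D e = e \<odot> D e + e \<odot> D e"
      using D_jordan[OF D e(1) e(1)] by (simp only: jordan_idem[OF e(2)] jordan_commute[of "D e"])
    also have "\<dots> = e \<cdot> D e + D e \<cdot> e" by (simp only: jordan_def half_add_half)
    finally show ?thesis by (rule sym)
  qed
  have "e \<cdot> (e \<cdot> D e + D e \<cdot> e) = e \<cdot> D e" by (simp only: De)
  then have "e \<cdot> (D e \<cdot> e) = 0" by (simp add: ring_rules e(3))
  then have "D' e = 0" using De e by (simp add: D'_def u_def ring_rules algebra_simps)
  from additive_if_kills_idempotent[OF D' ex this x y] show ?thesis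
    by (simp add: D'_def ring_rules algebra_simps)
qed

section \<open>Scaled identities for the normalised product\<close>

text \<open>For an idempotent \<open>p\<close> and \<open>d = \<delta> p\<close>, the rule for \<open>p \<odot> p\<close> multiplied by \<open>p\<close> from the left gives
  \<open>p c + p c p = 2 p d p\<close>, and from the right \<open>c p + p c p = 2 p d p\<close>.\<close>

lemma twisted_unit_central:
  assumes ex: "nontrivial_idempotent e" and \<delta>: "\<And>x. x \<in> A \<Longrightarrow> \<delta> x \<in> A" and c: "c \<in> A"
    and twist: "\<And>x y. \<lbrakk>x \<in> A; y \<in> A\<rbrakk> \<Longrightarrow> \<delta> (x \<odot> y) = \<delta> x \<odot> y + x \<odot> \<delta> y - (x \<odot> y) \<odot> c"
  shows "central c"
proof (rule commutes_with_idempotents_central[OF ex c])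
  fix p assume p: "p \<in> A" "p \<cdot> p = p"
  then have pp: "p \<cdot> (p \<cdot> x) = p \<cdot> x" for x by (simp flip: assoc)
  define d where "d = \<delta> p"
  have "d = p \<odot> d + p \<odot> d - p \<odot> c"
    using twist[OF p(1) p(1)] by (simp only: d_def jordan_idem[OF p(2)] jordan_commute[of "\<delta> p" p])
  then have "d + p \<odot> c = p \<odot> d + p \<odot> d" by (metis diff_add_cancel)
  then have "(d + p \<odot> c) + (d + p \<odot> c) = (p \<odot> d + p \<odot> d) + (p \<odot> d + p \<odot> d)" by (simp only:)
  then have *: "d + d + (p \<cdot> c + c \<cdot> p) = (p \<cdot> d + d \<cdot> p) + (p \<cdot> d + d \<cdot> p)"
    unfolding jordan_double by (simp only: add_ac)
  have "p \<cdot> c + p \<cdot> (c \<cdot> p) = p \<cdot> (d \<cdot> p) + p \<cdot> (d \<cdot> p)"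
    using arg_cong[OF *, of "\<lambda>u. p \<cdot> u"] by (simp add: ring_rules pp algebra_simps)
  moreover have "c \<cdot> p + p \<cdot> (c \<cdot> p) = p \<cdot> (d \<cdot> p) + p \<cdot> (d \<cdot> p)"
    using arg_cong[OF *, of "\<lambda>u. u \<cdot> p"] by (simp add: ring_rules p algebra_simps)
  ultimately show "c \<cdot> p = p \<cdot> c" by (metis add_right_cancel)
qed

text \<open>Without the factor \<open>N\<close> the rule \<open>\<delta> (x \<odot> y) = \<delta> x \<odot> y + x \<odot> \<delta> y - (x \<odot> y) \<odot> c\<close>
  remains, where \<open>c = \<delta> 1\<close>; it holds for the identity map and so cannot give \<open>c = 0\<close>. That comes
  from the value at \<open>N 1\<close>, which is \<open>N (2 + m) c\<close> by hypothesis. As \<open>N\<close> is a natural number,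
  additivity of \<open>x \<mapsto> \<delta> x - c x\<close> shows that it is also \<open>N c\<close>.\<close>

theorem scaled_mult_jordan_derivation_is_derivation:
  fixes N :: nat and m :: real
  assumes ex: "nontrivial_idempotent e" and \<delta>: "\<And>x. x \<in> A \<Longrightarrow> \<delta> x \<in> A"
    and N: "N > 0" and m: "m \<ge> 0"
    and eq: "\<And>x y. \<lbrakk>x \<in> A; y \<in> A\<rbrakk> \<Longrightarrow>
      \<delta> (real N *\<^sub>R (x \<odot> y)) = real N *\<^sub>R (\<delta> x \<odot> y + x \<odot> \<delta> y + m *\<^sub>R ((x \<odot> y) \<odot> \<delta> \<one>))"
    and x: "x \<in> A" and y: "y \<in> A"
  shows "\<delta> (x + y) = \<delta> x + \<delta> y" "\<delta> (x \<cdot> y) = \<delta> x \<cdot> y + x \<cdot> \<delta> y"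
proof -
  define c where "c = \<delta> \<one>"
  have c: "c \<in> A" using \<delta> by (simp add: c_def)
  have scale: "\<delta> (real N *\<^sub>R x) = real N *\<^sub>R (\<delta> x + x \<odot> c + m *\<^sub>R (x \<odot> c))" if "x \<in> A" for x
    using eq[OF that unit_in] by (simp add: c_def)
  have twist: "\<delta> (x \<odot> y) = \<delta> x \<odot> y + x \<odot> \<delta> y - (x \<odot> y) \<odot> c" if xy: "x \<in> A" "y \<in> A" for x y
  proof -
    have "real N *\<^sub>R (\<delta> (x \<odot> y) + (x \<odot> y) \<odot> c + m *\<^sub>R ((x \<odot> y) \<odot> c))
        = real N *\<^sub>R (\<delta> x \<odot> y + x \<odot> \<delta> y + m *\<^sub>R ((x \<odot> y) \<odot> c))"
      using scale[of "x \<odot> y"] eq[OF xy] xy by (simp only: c_def jordan_in)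
    then have "\<delta> (x \<odot> y) + (x \<odot> y) \<odot> c = \<delta> x \<odot> y + x \<odot> \<delta> y" using N by simp
    then show ?thesis by (simp add: eq_diff_eq)
  qed
  have cent: "central c" by (rule twisted_unit_central[OF ex \<delta> c twist])
  have jc: "x \<odot> c = c \<cdot> x" if "x \<in> A" for x
    using cent that by (simp add: jordan_def central_def scaleR_right_distrib half_add_half)
  define d where "d x = \<delta> x - c \<cdot> x" for x
  have d: "jordan_leibniz d"
    unfolding jordan_leibniz_def
  proof (intro conjI ballI)
    fix x y assume xy: "x \<in> A" "y \<in> A"
    show "d x \<in> A" using \<delta> c xy by (simp add: d_def)
    have "(c \<cdot> x) \<odot> y = c \<cdot> (x \<odot> y)" "x \<odot> (c \<cdot> y) = c \<cdot> (x \<odot> y)"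
    proof -
      have xc: "x \<cdot> c = c \<cdot> x" and yc: "y \<cdot> c = c \<cdot> y" using cent xy by (simp_all add: central_def)
      have "x \<cdot> (c \<cdot> z) = c \<cdot> (x \<cdot> z)" "y \<cdot> (c \<cdot> z) = c \<cdot> (y \<cdot> z)" for z
        using xc yc by (simp_all flip: assoc)
      then show "(c \<cdot> x) \<odot> y = c \<cdot> (x \<odot> y)" "x \<odot> (c \<cdot> y) = c \<cdot> (x \<odot> y)"
        by (simp_all add: jordan_def ring_rules)
    qed
    then show "d (x \<odot> y) = d x \<odot> y + x \<odot> d y"
      using twist[OF xy] jc[of "x \<odot> y"] xy by (simp add: d_def jordan_bilinear)
  qed
  have d_add: "d (x + y) = d x + d y" if "x \<in> A" "y \<in> A" for x y
    using jordan_leibniz_additive[OF d ex that] .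
  have d_nat: "d (real k *\<^sub>R \<one>) = real k *\<^sub>R d \<one>" for k
    by (induction k) (simp_all add: D_zero[OF d] d_add scaleR_left_distrib)
  have "c = 0"
  proof -
    have "\<delta> (real N *\<^sub>R \<one>) = real N *\<^sub>R c"
      using d_nat[of N] by (simp add: d_def c_def ring_rules)
    then have "real N *\<^sub>R (c + (c + m *\<^sub>R c)) = real N *\<^sub>R c"
      using scale[OF unit_in] by (simp add: c_def add.assoc)
    then have "c + (c + m *\<^sub>R c) = c" using N by (simp only: scaleR_cancel_left) simp
    then have "(1 + m) *\<^sub>R c = 0" by (simp add: scaleR_left_distrib)
    then show ?thesis using m by simp
  qed
  then have d_eq: "d = \<delta>" by (simp add: d_def fun_eq_iff)
  note add = d_add[unfolded d_eq] and \<delta>_jordan = D_jordan[OF d[unfolded d_eq]]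
  show "\<delta> (x + y) = \<delta> x + \<delta> y" using add[OF x y] .
  show "\<delta> (x \<cdot> y) = \<delta> x \<cdot> y + x \<cdot> \<delta> y"
  proof (rule jordan_derivation_is_derivation[OF not_commutative[OF ex] \<delta> add _ x y])
    fix x y assume xy: "x \<in> A" "y \<in> A"
    have "\<delta> (x \<cdot> y + y \<cdot> x) = (\<delta> x \<odot> y + \<delta> x \<odot> y) + (x \<odot> \<delta> y + x \<odot> \<delta> y)"
      unfolding jordan_double using add[of "x \<odot> y" "x \<odot> y"] \<delta>_jordan[OF xy] xy by (simp add: algebra_simps)
    then show "\<delta> (x \<cdot> y + y \<cdot> x) = \<delta> x \<cdot> y + x \<cdot> \<delta> y + \<delta> y \<cdot> x + y \<cdot> \<delta> x"
      by (simp only: jordan_double[symmetric] add_ac)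
  qed
qed

text \<open>Taking \<open>y = 1\<close> removes \<open>K\<close>, so \<open>g (x \<odot> y) = g x \<odot> y\<close> and \<open>g x = c \<odot> x\<close> with \<open>c = g 1\<close>. By
  symmetry \<open>(c \<odot> s) \<odot> t = (c \<odot> t) \<odot> s\<close>, which says that \<open>c\<close> commutes with \<open>s t - t s\<close>.\<close>

theorem scaled_jordan_centralizer_is_multiplication:
  fixes K :: real
  assumes g: "\<And>x. x \<in> A \<Longrightarrow> g x \<in> A" and K: "K \<noteq> 0"
    and eq: "\<And>x y. \<lbrakk>x \<in> A; y \<in> A\<rbrakk> \<Longrightarrow> g (K *\<^sub>R (x \<odot> y)) = K *\<^sub>R (g x \<odot> y)"
  shows "central (g \<one>)" "x \<in> A \<Longrightarrow> g x = g \<one> \<cdot> x"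
proof -
  define c where "c = g \<one>"
  have c: "c \<in> A" using g by (simp add: c_def)
  have g_jordan: "g (x \<odot> y) = g x \<odot> y" if "x \<in> A" "y \<in> A" for x y
    using eq[OF that] eq[of "x \<odot> y" \<one>] that K by simp
  have g_eq: "g x = c \<odot> x" if "x \<in> A" for x
    using g_jordan[OF unit_in that] by (simp add: c_def)
  have "central c"
  proof (rule commutes_with_commutators_central[OF c])
    fix s t assume st: "s \<in> A" "t \<in> A"
    have "(c \<odot> s) \<odot> t = (c \<odot> t) \<odot> s"
      using g_jordan[OF st] g_jordan[OF st(2) st(1)] st by (simp add: g_eq jordan_commute)
    then have "(c \<cdot> s + s \<cdot> c) \<cdot> t + t \<cdot> (c \<cdot> s + s \<cdot> c) = (c \<cdot> t + t \<cdot> c) \<cdot> s + s \<cdot> (c \<cdot> t + t \<cdot> c)"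
      by (simp add: jordan_def scaleR_mult mult_scaleR flip: scaleR_right_distrib)
    then show "c \<cdot> (s \<cdot> t - t \<cdot> s) = (s \<cdot> t - t \<cdot> s) \<cdot> c"
      by (simp add: ring_rules algebra_simps)
  qed
  then show "central (g \<one>)" by (simp add: c_def)
  show "g x = g \<one> \<cdot> x" if "x \<in> A"
    using g_eq[OF that] \<open>central c\<close> that
    by (simp add: jordan_def central_def c_def scaleR_right_distrib half_add_half)
qed

end

section \<open>Standard operator algebras\<close>

text \<open>The usual complexification \<open>g x = f x - i f (i x)\<close> of a real functional.\<close>

lemma exists_complex_functional:
  fixes v :: "'a::complex_banach"
  assumes "v \<noteq> 0"
  obtains g :: "'a \<Rightarrow> complex" where "\<And>x y. g (x + y) = g x + g y" "\<And>c x. g (c *\<^sub>C x) = c * g x"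
    "\<And>x. cmod (g x) \<le> 2 * norm x" "g v \<noteq> 0"
proof -
  obtain f where f: "linear f" "\<And>x. \<bar>f x\<bar> \<le> norm x" "f v = norm v"
    using exists_norming_functional[of v] by blast
  define g where "g x = Complex (f x) (- f (\<i> *\<^sub>C x))" for x
  have add: "g (x + y) = g x + g y" for x y
    by (simp add: g_def linear_add[OF f(1)] scaleC_add_right complex_eq_iff)
  have real: "g (complex_of_real r *\<^sub>C x) = complex_of_real r * g x" for r x
  proof -
    have cmul: "f (complex_of_real r *\<^sub>C y) = r * f y" for y
      using linear_cmul[OF f(1), of r y] by (simp add: scaleR_scaleC)
    have "f ((\<i> * complex_of_real r) *\<^sub>C x) = r * f (\<i> *\<^sub>C x)"
      using cmul[of "\<i> *\<^sub>C x"] by (simp add: mult.commute)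
    then show ?thesis using cmul by (simp add: g_def complex_eq_iff)
  qed
  have i: "g (\<i> *\<^sub>C x) = \<i> * g x" for x
  proof -
    have "\<i> *\<^sub>C (\<i> *\<^sub>C x) = - x"
      using scaleR_scaleC[of "-1" x] by (simp add: scaleC_scaleC)
    then show ?thesis by (simp add: g_def complex_eq_iff linear_neg[OF f(1)])
  qed
  have "g (c *\<^sub>C x) = c * g x" for c x
  proof -
    have "c *\<^sub>C x = complex_of_real (Re c) *\<^sub>C x + \<i> *\<^sub>C (complex_of_real (Im c) *\<^sub>C x)"
      using complex_eq[of c] by (metis scaleC_add_left scaleC_scaleC)
    then have "g (c *\<^sub>C x) = complex_of_real (Re c) * g x + \<i> * (complex_of_real (Im c) * g x)"
      by (simp only: add real i)
    also have "\<dots> = c * g x" by (subst (3) complex_eq) (simp add: algebra_simps)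
    finally show ?thesis .
  qed
  moreover have "cmod (g x) \<le> 2 * norm x" for x
    using cmod_le[of "g x"] f(2)[of x] f(2)[of "\<i> *\<^sub>C x"] by (simp add: g_def norm_scaleC)
  moreover have "g v \<noteq> 0" using f(3) assms by (auto simp: g_def complex_eq_iff)
  ultimately show thesis using that[of g] add by blast
qed

lemma standard_operator_algebraD:
  assumes "standard_operator_algebra A"
  shows "id_blinfun \<in> A" "\<lbrakk>S \<in> A; T \<in> A\<rbrakk> \<Longrightarrow> S + T \<in> A" "\<lbrakk>S \<in> A; T \<in> A\<rbrakk> \<Longrightarrow> S o\<^sub>L T \<in> A"
    "T \<in> A \<Longrightarrow> r *\<^sub>R T \<in> A" "T \<in> A \<Longrightarrow> T (c *\<^sub>C x) = c *\<^sub>C T x"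
    "\<lbrakk>T \<in> bounded_operators; finite_rank T\<rbrakk> \<Longrightarrow> T \<in> A"
proof -
  have "scaleC_blinfun (complex_of_real r) T = r *\<^sub>R T"
    by (rule blinfun_eqI) (simp add: scaleC_blinfun.rep_eq scaleR_scaleC blinfun.scaleR_left)
  then show "T \<in> A \<Longrightarrow> r *\<^sub>R T \<in> A"
    using assms unfolding standard_operator_algebra_def operator_subalgebra_def by metis
qed (use assms in \<open>auto simp: standard_operator_algebra_def operator_subalgebra_def bounded_operators_def\<close>)

lemma rank_one_operators:
  assumes A: "standard_operator_algebra (A :: ('a::complex_banach \<Rightarrow>\<^sub>L 'a) set)" and v: "v \<noteq> 0"
  obtains g where "g v = 1" "\<And>u. \<exists>R\<in>A. \<forall>x. R x = g x *\<^sub>C u"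
proof -
  obtain g0 :: "'a \<Rightarrow> complex" where add0: "\<And>x y. g0 (x + y) = g0 x + g0 y"
    and mult0: "\<And>c x. g0 (c *\<^sub>C x) = c * g0 x" and le0: "\<And>x. cmod (g0 x) \<le> 2 * norm x" and v0: "g0 v \<noteq> 0"
    using exists_complex_functional[OF v] by blast
  define g where "g x = g0 x / g0 v" for x
  have add: "g (x + y) = g x + g y" and mult: "g (c *\<^sub>C x) = c * g x" for c x y
    by (simp_all add: g_def add0 mult0 add_divide_distrib)
  have gv: "g v = 1" using v0 by (simp add: g_def)
  have "\<exists>R\<in>A. \<forall>x. R x = g x *\<^sub>C u" for u
  proof -
    have bl: "bounded_linear (\<lambda>x. g x *\<^sub>C u)"
    proof (rule bounded_linear_intro[where K = "2 / cmod (g0 v) * norm u"])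
      show "g (x + y) *\<^sub>C u = g x *\<^sub>C u + g y *\<^sub>C u" for x y by (simp add: add scaleC_add_left)
      show "g (r *\<^sub>R x) *\<^sub>C u = r *\<^sub>R g x *\<^sub>C u" for r x
        by (simp add: scaleR_scaleC mult scaleC_scaleC)
      show "norm (g x *\<^sub>C u) \<le> norm x * (2 / cmod (g0 v) * norm u)" for x
        using mult_right_mono[OF divide_right_mono[OF le0[of x], of "cmod (g0 v)"], of "norm u"]
        by (simp add: norm_scaleC g_def norm_divide field_simps)
    qed
    define R where "R = Blinfun (\<lambda>x. g x *\<^sub>C u)"
    have R: "R x = g x *\<^sub>C u" for x
      using bounded_linear_Blinfun_apply[OF bl] by (simp add: R_def)
    have "R \<in> bounded_operators" by (simp add: bounded_operators_def R mult scaleC_scaleC)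
    moreover have "finite_rank R"
      unfolding finite_rank_def
    proof (intro exI conjI)
      show "range R = complex_vector.span {u}"
      proof -
        have "c *\<^sub>C u = R (c *\<^sub>C v)" for c by (simp only: R mult gv mult_1_right)
        then have "range (\<lambda>c. c *\<^sub>C u) \<subseteq> range R" by blast
        moreover have "range R \<subseteq> range (\<lambda>c. c *\<^sub>C u)" using R by blast
        ultimately have "range R = range (\<lambda>c. c *\<^sub>C u)" by blast
        then show ?thesis by (simp only: complex_vector.span_singleton)
      qed
    qed simp
    ultimately show ?thesis using standard_operator_algebraD(6)[OF A] R by blast
  qed
  then show thesis using that gv by blast
qed

text \<open>If \<open>S x\<close> and \<open>T y\<close> are nonzero, some rank-one operator maps \<open>T y\<close> to \<open>x\<close>, so \<open>S R T\<close> is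
  nonzero at \<open>y\<close>.\<close>

lemma standard_operator_algebra_prime:
  assumes A: "standard_operator_algebra A"
  shows "prime_algebra A (o\<^sub>L) id_blinfun"
proof (unfold_locales)
  note bil = bounded_bilinear_blinfun_compose
  fix S T U :: "'a \<Rightarrow>\<^sub>L 'a" and r :: real
  show "S o\<^sub>L T o\<^sub>L U = S o\<^sub>L (T o\<^sub>L U)" by (rule blinfun_eqI) simp
  show "(S + T) o\<^sub>L U = (S o\<^sub>L U) + (T o\<^sub>L U)" "S o\<^sub>L (T + U) = (S o\<^sub>L T) + (S o\<^sub>L U)"
    "(r *\<^sub>R S) o\<^sub>L T = r *\<^sub>R (S o\<^sub>L T)" "S o\<^sub>L (r *\<^sub>R T) = r *\<^sub>R (S o\<^sub>L T)"
    by (simp_all add: bounded_bilinear.add_left[OF bil] bounded_bilinear.add_right[OF bil]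
        bounded_bilinear.scaleR_left[OF bil] bounded_bilinear.scaleR_right[OF bil])
  show "id_blinfun o\<^sub>L S = S" "S o\<^sub>L id_blinfun = S" by (rule blinfun_eqI, simp)+
  show "S = 0 \<or> T = 0" if S: "S \<in> A" and T: "T \<in> A" and zero: "\<And>R. R \<in> A \<Longrightarrow> S o\<^sub>L R o\<^sub>L T = 0"
  proof (rule ccontr)
    assume "\<not> (S = 0 \<or> T = 0)"
    then obtain x y where x: "S x \<noteq> 0" and y: "T y \<noteq> 0"
      by (metis blinfun_eqI zero_blinfun.rep_eq)
    obtain g where g: "g (T y) = 1" "\<And>u. \<exists>R\<in>A. \<forall>x. R x = g x *\<^sub>C u"
      using rank_one_operators[OF A y] by blast
    obtain R where R: "R \<in> A" "\<And>z. R z = g z *\<^sub>C x" using g(2) by blast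
    have "S x = (S o\<^sub>L R o\<^sub>L T) y" by (simp add: R g(1) scaleC_one)
    then show False using zero[OF R(1)] x by simp
  qed
qed (use standard_operator_algebraD[OF A] in auto)

text \<open>A rank-one projection; it is not the identity because the space is not one line.\<close>

lemma standard_operator_algebra_idempotent:
  fixes A :: "('a::complex_banach \<Rightarrow>\<^sub>L 'a) set"
  assumes A: "standard_operator_algebra A" and dim: "complex_dim_gt_one TYPE('a)"
  obtains e where "e \<in> A" "e o\<^sub>L e = e" "e \<noteq> 0" "e \<noteq> id_blinfun"
proof -
  obtain B :: "'a set" where B: "complex_vector.independent B" "infinite B \<or> card B > 1"
    using dim by (auto simp: complex_dim_gt_one_def)
  then have "B \<noteq> {}" by auto
  then obtain v where v: "v \<in> B" by blast
  then have "v \<noteq> 0" using B(1) complex_vector.dependent_zero by blast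
  from rank_one_operators[OF A this] obtain g where g: "g v = 1" "\<And>u. \<exists>R\<in>A. \<forall>x. R x = g x *\<^sub>C u"
    by blast
  obtain e where e: "e \<in> A" "\<And>x. e x = g x *\<^sub>C v" using g(2) by blast
  have ev: "e v = v" by (simp add: e g scaleC_one)
  have "e o\<^sub>L e = e"
  proof (rule blinfun_eqI)
    fix x
    have "e (e x) = e (g x *\<^sub>C v)" by (simp only: e(2)[of x])
    also have "\<dots> = g x *\<^sub>C e v" using standard_operator_algebraD(5)[OF A e(1)] .
    also have "\<dots> = e x" by (simp only: ev e(2)[of x])
    finally show "(e o\<^sub>L e) x = e x" by simp
  qed
  moreover have "e \<noteq> 0" using ev \<open>v \<noteq> 0\<close> by auto
  moreover have "e \<noteq> id_blinfun"
  proof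
    assume "e = id_blinfun"
    then have "x = g x *\<^sub>C v" for x using e(2)[of x] by simp
    then have "B \<subseteq> complex_vector.span {v}" by (metis complex_vector.span_singleton rangeI subsetI)
    then have "finite B \<and> card B \<le> card {v}"
      using complex_vector.independent_span_bound[of "{v}" B] B(1) by simp
    then show False using B(2) by simp
  qed
  ultimately show thesis using that e(1) by blast
qed

section \<open>Iterated Jordan products with unit entries\<close>

lemma jordan_product_id: "jordan_product S id_blinfun = 2 *\<^sub>R S"
  by (rule blinfun_eqI) (simp add: jordan_product_def blinfun.bilinear_simps scaleR_2)

lemma jordan_product_scaleR_left: "jordan_product (r *\<^sub>R S) T = r *\<^sub>R jordan_product S T"
  by (rule blinfun_eqI) (simp add: jordan_product_def blinfun.bilinear_simps scaleR_right_distrib)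

lemma jordan_q_trailing_units:
  assumes "\<And>i. \<lbrakk>3 \<le> i; i \<le> k + 2\<rbrakk> \<Longrightarrow> t i = id_blinfun"
  shows "jordan_q (k + 2) t = 2 ^ k *\<^sub>R jordan_product (t 1) (t 2)"
  using assms
proof (induction k)
  case (Suc k)
  then have "jordan_q (k + 2) t = 2 ^ k *\<^sub>R jordan_product (t 1) (t 2)" "t (k + 3) = id_blinfun" by auto
  then show ?case by (simp add: jordan_product_id eval_nat_numeral)
qed (simp add: numeral_2_eq_2)

text \<open>The entry \<open>t j\<close> takes the place of a unit, which would have contributed the factor \<open>2\<close>.\<close>

lemma jordan_q_one_late_entry:
  assumes "3 \<le> j" "j \<le> k + 2" "\<And>i. \<lbrakk>3 \<le> i; i \<le> k + 2; i \<noteq> j\<rbrakk> \<Longrightarrow> t i = id_blinfun"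
  shows "jordan_q (k + 2) t = (2 ^ k / 2) *\<^sub>R jordan_product (jordan_product (t 1) (t 2)) (t j)"
  using assms
proof (induction k)
  case (Suc k)
  have step: "jordan_q (Suc k + 2) t = jordan_product (jordan_q (k + 2) t) (t (k + 3))"
    by (simp add: eval_nat_numeral)
  show ?case
  proof (cases "j = k + 3")
    case True
    have "jordan_q (k + 2) t = 2 ^ k *\<^sub>R jordan_product (t 1) (t 2)"
      using Suc.prems True by (intro jordan_q_trailing_units) auto
    then show ?thesis unfolding step by (simp add: True jordan_product_scaleR_left)
  next
    case False
    then have "jordan_q (k + 2) t = (2 ^ k / 2) *\<^sub>R jordan_product (jordan_product (t 1) (t 2)) (t j)"
      using Suc.prems by (intro Suc.IH) auto
    moreover have "t (k + 3) = id_blinfun" using Suc.prems False by auto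
    ultimately show ?thesis unfolding step by (simp add: jordan_product_id)
  qed
qed simp

definition pair_then_units :: "('a::complex_banach \<Rightarrow>\<^sub>L 'a) \<Rightarrow> ('a \<Rightarrow>\<^sub>L 'a) \<Rightarrow> nat \<Rightarrow> ('a \<Rightarrow>\<^sub>L 'a)" where
  "pair_then_units S T i = (if i = 1 then S else if i = 2 then T else id_blinfun)"

lemma jordan_q_pair_then_units:
  "jordan_q (k + 2) (pair_then_units S T) = 2 ^ k *\<^sub>R jordan_product S T"
  "jordan_q (k + 2) ((pair_then_units S T)(1 := U)) = 2 ^ k *\<^sub>R jordan_product U T"
  "(\<Sum>i=2..k + 2. jordan_q (k + 2) ((pair_then_units S T)(i := \<delta> (pair_then_units S T i))))
    = 2 ^ k *\<^sub>R jordan_product S (\<delta> T)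
      + (real k * (2 ^ k / 2)) *\<^sub>R jordan_product (jordan_product S T) (\<delta> id_blinfun)"
proof -
  let ?t = "pair_then_units S T"
  show "jordan_q (k + 2) ?t = 2 ^ k *\<^sub>R jordan_product S T"
    "jordan_q (k + 2) (?t(1 := U)) = 2 ^ k *\<^sub>R jordan_product U T"
    by (subst jordan_q_trailing_units; simp add: pair_then_units_def)+
  have two: "jordan_q (k + 2) (?t(2 := \<delta> (?t 2))) = 2 ^ k *\<^sub>R jordan_product S (\<delta> T)"
    by (subst jordan_q_trailing_units; simp add: pair_then_units_def)
  have late: "jordan_q (k + 2) (?t(i := \<delta> (?t i)))
      = (2 ^ k / 2) *\<^sub>R jordan_product (jordan_product S T) (\<delta> id_blinfun)"
    if "i \<in> {3..k + 2}" for i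
    by (subst jordan_q_one_late_entry[of i]; use that in \<open>simp add: pair_then_units_def\<close>)
  have "(\<Sum>i=2..k + 2. jordan_q (k + 2) (?t(i := \<delta> (?t i))))
      = jordan_q (k + 2) (?t(2 := \<delta> (?t 2))) + (\<Sum>i=3..k + 2. jordan_q (k + 2) (?t(i := \<delta> (?t i))))"
    by (subst sum.atLeast_Suc_atMost) simp_all
  also have "(\<Sum>i=3..k + 2. jordan_q (k + 2) (?t(i := \<delta> (?t i))))
      = (\<Sum>i=3..k + 2. (2 ^ k / 2) *\<^sub>R jordan_product (jordan_product S T) (\<delta> id_blinfun))"
    using late by (intro sum.cong) auto
  also have "\<dots> = (real k * (2 ^ k / 2)) *\<^sub>R jordan_product (jordan_product S T) (\<delta> id_blinfun)"
    by (simp add: sum_constant_scaleR)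
  finally show "(\<Sum>i=2..k + 2. jordan_q (k + 2) (?t(i := \<delta> (?t i))))
    = 2 ^ k *\<^sub>R jordan_product S (\<delta> T)
      + (real k * (2 ^ k / 2)) *\<^sub>R jordan_product (jordan_product S T) (\<delta> id_blinfun)"
    by (simp only: two)
qed

section \<open>Multiplicative generalized Jordan derivations\<close>

theorem corollary4p7:
  fixes n :: nat
    and A :: "('a::complex_banach \<Rightarrow>\<^sub>L 'a) set"
    and \<Delta> :: "('a \<Rightarrow>\<^sub>L 'a) \<Rightarrow> ('a \<Rightarrow>\<^sub>L 'a)"
  assumes "n \<ge> 2"
    and "complex_dim_gt_one TYPE('a)"
    and "standard_operator_algebra A"
    and "mult_gen_jordan_derivation n A \<Delta>"
  shows "\<exists>\<mu>\<in>center A. \<exists>\<delta>. derivation A \<delta> \<and> (\<forall>t\<in>A. \<Delta> t = (\<mu> o\<^sub>L t) + \<delta> t)"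
proof -
  interpret prime_algebra A "(o\<^sub>L)" id_blinfun
    using assms(3) by (rule standard_operator_algebra_prime)
  obtain e where ex: "nontrivial_idempotent e"
    using standard_operator_algebra_idempotent[OF assms(3,2)] unfolding nontrivial_idempotent_def by blast
  obtain k where n: "n = k + 2" using assms(1) by (metis le_add_diff_inverse2)
  define N :: nat where "N = 2 ^ Suc k"
  obtain \<delta> where \<Delta>: "\<Delta> \<in> A \<rightarrow> A" and \<delta>: "\<delta> \<in> A \<rightarrow> A"
    and \<delta>_eq: "\<And>t. \<forall>i\<in>{1..n}. t i \<in> A \<Longrightarrow> \<delta> (jordan_q n t) = (\<Sum>i=1..n. jordan_q n (t(i := \<delta> (t i))))"
    and \<Delta>_eq: "\<And>t. \<forall>i\<in>{1..n}. t i \<in> A \<Longrightarrow>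
        \<Delta> (jordan_q n t) = jordan_q n (t(1 := \<Delta> (t 1))) + (\<Sum>i=2..n. jordan_q n (t(i := \<delta> (t i))))"
    using assms(4) by (auto simp: mult_gen_jordan_derivation_def mult_jordan_derivation_def)
  have jp: "jordan_product S T = 2 *\<^sub>R (jordan S T)" for S T
    by (simp add: jordan_def jordan_product_def)
  \<comment> \<open>the defining identities at the entries \<open>S, T, 1, \<dots>, 1\<close>\<close>
  have main: "\<delta> (real N *\<^sub>R (jordan S T)) = real N *\<^sub>R (jordan (\<delta> S) T + jordan S (\<delta> T) + real k *\<^sub>R (jordan (jordan S T) (\<delta> id_blinfun)))"
     "\<Delta> (real N *\<^sub>R (jordan S T)) = real N *\<^sub>R (jordan (\<Delta> S) T + jordan S (\<delta> T) + real k *\<^sub>R (jordan (jordan S T) (\<delta> id_blinfun)))"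
    if "S \<in> A" "T \<in> A" for S T
  proof -
    let ?t = "pair_then_units S T"
    have in_A: "\<forall>i\<in>{1..n}. ?t i \<in> A" using that by (simp add: pair_then_units_def)
    have q: "jordan_q n ?t = real N *\<^sub>R (jordan S T)"
      unfolding n jordan_q_pair_then_units by (simp add: jp N_def)
    have t1: "?t 1 = S" by (simp add: pair_then_units_def)
    have rest: "jordan_q n (?t(1 := U)) + (\<Sum>i=2..n. jordan_q n (?t(i := \<delta> (?t i))))
        = real N *\<^sub>R (jordan U T + jordan S (\<delta> T) + real k *\<^sub>R (jordan (jordan S T) (\<delta> id_blinfun)))" for U
      unfolding n jordan_q_pair_then_units
      by (simp add: jp N_def jordan_bilinear algebra_simps)
    have split: "(\<Sum>i=1..n. jordan_q n (?t(i := \<delta> (?t i))))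
        = jordan_q n (?t(1 := \<delta> (?t 1))) + (\<Sum>i=2..n. jordan_q n (?t(i := \<delta> (?t i))))"
      using assms(1) by (subst sum.atLeast_Suc_atMost) (simp_all add: numeral_2_eq_2)
    show "\<delta> (real N *\<^sub>R (jordan S T)) = real N *\<^sub>R (jordan (\<delta> S) T + jordan S (\<delta> T) + real k *\<^sub>R (jordan (jordan S T) (\<delta> id_blinfun)))"
      using \<delta>_eq[OF in_A] unfolding split q rest t1 .
    show "\<Delta> (real N *\<^sub>R (jordan S T)) = real N *\<^sub>R (jordan (\<Delta> S) T + jordan S (\<delta> T) + real k *\<^sub>R (jordan (jordan S T) (\<delta> id_blinfun)))"
      using \<Delta>_eq[OF in_A] unfolding q rest t1 .
  qed
  have \<delta>_in: "\<And>x. x \<in> A \<Longrightarrow> \<delta> x \<in> A" using \<delta> by auto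
  have N: "N > 0" by (simp add: N_def)
  note der = scaled_mult_jordan_derivation_is_derivation[OF ex \<delta>_in N _ main(1)]
  have "derivation A \<delta>" unfolding derivation_def using \<delta> der by simp
  define g where "g S = \<Delta> S - \<delta> S" for S
  have g_in: "g x \<in> A" if "x \<in> A" for x using that \<Delta> \<delta> unfolding g_def by (intro diff_in) auto
  have g_eq: "g (real N *\<^sub>R (jordan S T)) = real N *\<^sub>R (jordan (g S) T)" if "S \<in> A" "T \<in> A" for S T
    unfolding g_def main[OF that] by (simp add: jordan_bilinear algebra_simps)
  have N': "real N \<noteq> 0" using N by simp
  note g = scaled_jordan_centralizer_is_multiplication[OF g_in N' g_eq]
  have "g id_blinfun \<in> center A"
    using g(1) g_in by (simp add: center_def central_def)
  moreover have "\<forall>t\<in>A. \<Delta> t = (g id_blinfun o\<^sub>L t) + \<delta> t"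
    using g(2) by (metis diff_add_cancel g_def)
  ultimately show ?thesis using \<open>derivation A \<delta>\<close> by blast
qed

end
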